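(* Let $(\xi_k)_{k\ge1}$ and $(\rho_k)_{k\ge1}$ be two independent i.i.d. sequences with $\rho_k>0$ a.s., $\xi_1$ and $\ln\rho_1$ square-integrable with $\sigma_\xi^2=\mathrm{Var}(\xi_1)>0$, $\sigma_\rho^2=\mathrm{Var}(\ln\rho_1)>0$; let $\mu_\xi=\mathbf{E}\xi_1$, $\mu_\rho=\mathbf{E}\ln\rho_1$, $\kappa_\rho=\mu_\rho+\sigma_\rho^2/2$. Fix $y\in\mathbb{R}$ and let $\gamma^{(n)}_1$, $\theta^{(n)}$ and $Y$ be as in the context. Assume that for some integer $q\ge2$, $\mathbf{E}(|\xi_1|^q)<\infty$ and $$\sup_{n\in\mathbb{N}^*}\left(\mathbf{E}\left(e^{q\gamma^{(n)}_1}\right)\right)^n<\infty.$$ Then for every integer $p$ with $1\le p<q$, $$\lim_{n\to\infty}\mathbf{E}[(\theta^{(n)}_1)^p]=\mathbf{E}[(Y_1)^p]=m_p(1),$$ where $m_0\equiv1$, $m_1(t)=ye^{\kappa_\rho t}+\frac{\mu_\xi}{\kappa_\rho}(e^{\kappa_\rho t}-1)$ if $\kappa_\rho\ne0$ and $m_1(t)=y+\mu_\xi t$ if $\kappa_\rho=0$, and for $p\ge2$, $m_p(t)=y^pe^{a_pt}+\int_0^te^{a_p(t-s)}(b_pm_{p-1}(s)+c_pm_{p-2}(s))ds$ with $a_p=p\mu_\rho+p^2\sigma_\rho^2/2$, $b_p=p\mu_\xi$, $c_p=p(p-1)\sigma_\xi^2/2$.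
   Context: Define $\xi^{(n)}_k=\mu_\xi/n+(\xi_k-\mu_\xi)/\sqrt n$, $\gamma^{(n)}_k=\mu_\rho/n+(\ln\rho_k-\mu_\rho)/\sqrt n$, $\rho^{(n)}_k=e^{\gamma^{(n)}_k}$, $\theta^{(n)}(0)=y$, $\theta^{(n)}(k/n)=\xi^{(n)}_k+\theta^{(n)}((k-1)/n)\rho^{(n)}_k$ for $k\ge1$, and $\theta^{(n)}_t=\theta^{(n)}([nt]/n)$ ($[\cdot]$ = floor), so $\theta^{(n)}_1=\theta^{(n)}(1)$. $Y_t=e^{R_t}(y+\int_{0+}^te^{-R_{s-}}dX_s)$ with $R_t=\mu_\rho t+\sigma_\rho W_t$, $X_t=\mu_\xi t+\sigma_\xi\tilde W_t$, $W,\tilde W$ independent standard Brownian motions. *)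

theory Defs
  imports "HOL-Probability.Probability"
begin

definition xi_n :: "(nat \<Rightarrow> 'a \<Rightarrow> real) \<Rightarrow> real \<Rightarrow> nat \<Rightarrow> nat \<Rightarrow> 'a \<Rightarrow> real" where
  "xi_n \<xi> \<mu>\<xi> n k x = \<mu>\<xi> / real n + (\<xi> k x - \<mu>\<xi>) / sqrt (real n)"

definition gamma_n :: "(nat \<Rightarrow> 'a \<Rightarrow> real) \<Rightarrow> real \<Rightarrow> nat \<Rightarrow> nat \<Rightarrow> 'a \<Rightarrow> real" where
  "gamma_n \<rho> \<mu>\<rho> n k x = \<mu>\<rho> / real n + (ln (\<rho> k x) - \<mu>\<rho>) / sqrt (real n)"

definition rho_n :: "(nat \<Rightarrow> 'a \<Rightarrow> real) \<Rightarrow> real \<Rightarrow> nat \<Rightarrow> nat \<Rightarrow> 'a \<Rightarrow> real" where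
  "rho_n \<rho> \<mu>\<rho> n k x = exp (gamma_n \<rho> \<mu>\<rho> n k x)"

text \<open>theta_grid ... n k x is theta^(n)(k/n) evaluated at the outcome x.\<close>
fun theta_grid :: "(nat \<Rightarrow> 'a \<Rightarrow> real) \<Rightarrow> (nat \<Rightarrow> 'a \<Rightarrow> real) \<Rightarrow> real \<Rightarrow> real \<Rightarrow> real
    \<Rightarrow> nat \<Rightarrow> nat \<Rightarrow> 'a \<Rightarrow> real" where
  "theta_grid \<xi> \<rho> \<mu>\<xi> \<mu>\<rho> y n 0 x = y"
| "theta_grid \<xi> \<rho> \<mu>\<xi> \<mu>\<rho> y n (Suc k) x =
     xi_n \<xi> \<mu>\<xi> n (Suc k) x + theta_grid \<xi> \<rho> \<mu>\<xi> \<mu>\<rho> y n k x * rho_n \<rho> \<mu>\<rho> n (Suc k) x"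

definition theta :: "(nat \<Rightarrow> 'a \<Rightarrow> real) \<Rightarrow> (nat \<Rightarrow> 'a \<Rightarrow> real) \<Rightarrow> real \<Rightarrow> real \<Rightarrow> real
    \<Rightarrow> nat \<Rightarrow> real \<Rightarrow> 'a \<Rightarrow> real" where
  "theta \<xi> \<rho> \<mu>\<xi> \<mu>\<rho> y n t x = theta_grid \<xi> \<rho> \<mu>\<xi> \<mu>\<rho> y n (nat \<lfloor>real n * t\<rfloor>) x"

definition brownian_motion :: "'b measure \<Rightarrow> (real \<Rightarrow> 'b \<Rightarrow> real) \<Rightarrow> bool" where
  "brownian_motion N W \<longleftrightarrow>
     prob_space N \<and>
     (\<forall>t\<ge>0. W t \<in> borel_measurable N) \<and>
     (\<forall>\<omega>\<in>space N. W 0 \<omega> = 0 \<and> continuous_on {0..} (\<lambda>t. W t \<omega>)) \<and>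
     (\<forall>s t. 0 \<le> s \<and> s < t \<longrightarrow>
        distributed N lborel (\<lambda>\<omega>. W t \<omega> - W s \<omega>) (normal_density 0 (sqrt (t - s)))) \<and>
     (\<forall>(ts :: nat \<Rightarrow> real) k. 0 \<le> ts 0 \<and> (\<forall>i<k. ts i < ts (Suc i)) \<longrightarrow>
        prob_space.indep_vars N (\<lambda>_. borel) (\<lambda>i \<omega>. W (ts (Suc i)) \<omega> - W (ts i) \<omega>) {..<k})"

definition process_sigma :: "'b measure \<Rightarrow> (real \<Rightarrow> 'b \<Rightarrow> real) \<Rightarrow> 'b set set" where
  "process_sigma N W = sigma_sets (space N)
     (\<Union>t\<in>{0..}. {W t -` B \<inter> space N | B. B \<in> sets borel})"

definition indep_brownian_motions :: "'b measure \<Rightarrow> (real \<Rightarrow> 'b \<Rightarrow> real) \<Rightarrow> (real \<Rightarrow> 'b \<Rightarrow> real) \<Rightarrow> bool" where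
  "indep_brownian_motions N W W' \<longleftrightarrow>
     brownian_motion N W \<and> brownian_motion N W' \<and>
     prob_space.indep_set N (process_sigma N W) (process_sigma N W')"

definition tendsto_in_prob :: "'b measure \<Rightarrow> (nat \<Rightarrow> 'b \<Rightarrow> real) \<Rightarrow> ('b \<Rightarrow> real) \<Rightarrow> bool" where
  "tendsto_in_prob N S I \<longleftrightarrow>
     (\<forall>\<epsilon>>0. (\<lambda>m. measure N {\<omega>\<in>space N. \<bar>S m \<omega> - I \<omega>\<bar> > \<epsilon>}) \<longlonglongrightarrow> 0)"

definition riemann_sum :: "(real \<Rightarrow> 'b \<Rightarrow> real) \<Rightarrow> (real \<Rightarrow> 'b \<Rightarrow> real) \<Rightarrow> nat \<Rightarrow> 'b \<Rightarrow> real" where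
  "riemann_sum H Z m \<omega> =
     (\<Sum>i<2^m. H (real i / 2^m) \<omega> * (Z (real (Suc i) / 2^m) \<omega> - Z (real i / 2^m) \<omega>))"

text \<open>I is (a version of) the Ito integral int_{0+}^1 H_{s-} dZ_s for continuous adapted H\<close>
definition is_ito_integral_01 :: "'b measure \<Rightarrow> (real \<Rightarrow> 'b \<Rightarrow> real) \<Rightarrow> (real \<Rightarrow> 'b \<Rightarrow> real) \<Rightarrow> ('b \<Rightarrow> real) \<Rightarrow> bool" where
  "is_ito_integral_01 N H Z I \<longleftrightarrow>
     I \<in> borel_measurable N \<and> tendsto_in_prob N (riemann_sum H Z) I"

fun mom :: "real \<Rightarrow> real \<Rightarrow> real \<Rightarrow> real \<Rightarrow> real \<Rightarrow> nat \<Rightarrow> real \<Rightarrow> real" where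
  "mom y \<mu>\<xi> \<sigma>\<xi> \<mu>\<rho> \<sigma>\<rho> 0 t = 1"
| "mom y \<mu>\<xi> \<sigma>\<xi> \<mu>\<rho> \<sigma>\<rho> (Suc 0) t =
     (let \<kappa> = \<mu>\<rho> + \<sigma>\<rho>^2 / 2 in
      if \<kappa> \<noteq> 0 then y * exp (\<kappa> * t) + \<mu>\<xi> / \<kappa> * (exp (\<kappa> * t) - 1)
      else y + \<mu>\<xi> * t)"
| "mom y \<mu>\<xi> \<sigma>\<xi> \<mu>\<rho> \<sigma>\<rho> (Suc (Suc k)) t =
     (let p = Suc (Suc k);
          a = real p * \<mu>\<rho> + (real p)^2 * \<sigma>\<rho>^2 / 2;
          b = real p * \<mu>\<xi>;
          c = real p * (real p - 1) * \<sigma>\<xi>^2 / 2 in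
      y ^ p * exp (a * t) +
      integral {0..t} (\<lambda>s. exp (a * (t - s)) *
         (b * mom y \<mu>\<xi> \<sigma>\<xi> \<mu>\<rho> \<sigma>\<rho> (Suc k) s + c * mom y \<mu>\<xi> \<sigma>\<xi> \<mu>\<rho> \<sigma>\<rho> k s)))"

end

theory Submission
  imports Defs "HOL-Real_Asymp.Real_Asymp"
begin

text \<open>Both \<open>\<theta>\<^sup>(\<^sup>n\<^sup>)\<close> and the Riemann-sum approximations of \<open>Y\<close> on the grid \<open>k/n\<close> satisfy a linear recursion
  \<open>T\<^sub>k\<^sub>+\<^sub>1 = U\<^sub>k\<^sub>+\<^sub>1 d(V\<^sub>k\<^sub>+\<^sub>1) + T\<^sub>k V\<^sub>k\<^sub>+\<^sub>1\<close> with independent coefficients, with \<open>d = 1\<close> and \<open>d(v) = v\<close> respectively.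
  By the binomial theorem the moments of \<open>T\<^sub>k\<close> then satisfy a linear recursion whose matrix is
  \<open>1 + A/n + o(1/n)\<close>, that is, a perturbed Euler scheme for the triangular linear differential equation solved
  by the functions \<open>m\<^sub>p\<close>; hence the moments at \<open>k = n\<close> converge to \<open>m\<^sub>p(1)\<close> in both cases.
  The supremum condition enters only in \<open>E exp(i \<gamma>\<^sup>(\<^sup>n\<^sup>)) = 1 + (i \<mu> + i\<^sup>2 \<sigma>\<^sup>2/2)/n + o(1/n)\<close> for \<open>i < q\<close>.
  For \<open>Y\<close> all moments of the approximations are bounded, so convergence in probability of the Riemann sums
  carries the limit of the moments over to \<open>Y\<^sub>1\<close>.\<close>

subsection \<open>Euler schemes for the moment equations\<close>

text \<open>The Ito integral enters only through its defining Riemann sums. The delicate point is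
  the expansion of the exponential moments. The hypothesis bounds n-th powers of expectations E,
  whereas the expansion concerns \<open>n * (E - 1)\<close>; Bernoulli's inequality bridges the two.
  For centred Z the linear term of the exponential can be subtracted for free, and convexity makes
  the remainder nonnegative. For m < q the remainder at exponent m is at most an arbitrarily small
  multiple of the remainder at exponent q plus a multiple of Z^2. Hence what lies above a fixed
  multiple of Z^2 has uniformly small expectation, and what lies below it has an integrable
  majorant.\<close>

lemma discrete_gronwall:
  fixes e :: "nat \<Rightarrow> nat \<Rightarrow> real"
  assumes n: "n \<ge> 1" and L: "L \<ge> 0" and d: "\<delta> \<ge> 0"
    and init: "\<And>p. p \<le> P \<Longrightarrow> e 0 p = 0"
    and step: "\<And>k p B. k < n \<Longrightarrow> p \<le> P \<Longrightarrow> B \<ge> 0 \<Longrightarrow> (\<And>i. i \<le> P \<Longrightarrow> \<bar>e k i\<bar> \<le> B)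
        \<Longrightarrow> \<bar>e (Suc k) p\<bar> \<le> (1 + L / n) * B + \<delta> / n"
    and p: "p \<le> P"
  shows "\<bar>e n p\<bar> \<le> \<delta> * exp L"
proof -
  \<comment> \<open>The induction carries the factor \<open>k / n\<close>: each of the k steps so
    far contributed \<open>\<delta> / n\<close>, and each contribution was amplified by at most
    \<open>exp (L * k / n)\<close>.\<close>
  have "k \<le> n \<Longrightarrow> p \<le> P \<Longrightarrow> \<bar>e k p\<bar> \<le> k / n * \<delta> * exp (L * k / n)" for k p
  proof (induction k arbitrary: p)
    case 0
    then show ?case using init by simp
  next
    case (Suc k)
    define B where "B = k / n * \<delta> * exp (L * k / n)"
    have "B \<ge> 0" using d by (simp add: B_def)
    moreover have "\<And>i. i \<le> P \<Longrightarrow> \<bar>e k i\<bar> \<le> B"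
      using Suc unfolding B_def by simp
    ultimately have "\<bar>e (Suc k) p\<bar> \<le> (1 + L / n) * B + \<delta> / n"
      using Suc.prems by (intro step) auto
    also have "\<dots> \<le> exp (L / n) * B + \<delta> / n * exp (L * Suc k / n)"
    proof (intro add_mono mult_right_mono)
      have "1 \<le> exp (L * Suc k / n)" using L by simp
      then show "\<delta> / n \<le> \<delta> / n * exp (L * Suc k / n)"
        using d by (metis divide_nonneg_nonneg mult.right_neutral mult_left_mono of_nat_0_le_iff)
    qed (use \<open>B \<ge> 0\<close> in auto)
    also have "exp (L / n) * B = k / n * \<delta> * exp (L * Suc k / n)"
      by (simp add: B_def algebra_simps add_divide_distrib flip: exp_add)
    also have "\<dots> + \<delta> / n * exp (L * Suc k / n) = Suc k / n * \<delta> * exp (L * Suc k / n)"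
      using n by (simp add: field_simps)
    finally show ?case .
  qed
  from this[of n p] show ?thesis using n p by simp
qed

text \<open>By the mean value theorem the increment is the derivative at an intermediate point times
  \<open>1 / n\<close>, and uniform continuity of \<open>f'\<close> moves that point to the left end
  of the cell. A continuous first derivative thus gives a local error o(1/n) uniformly in k, small
  enough to be summed over n steps.\<close>

lemma uniform_taylor1:
  fixes f f' :: "real \<Rightarrow> real"
  assumes der: "\<And>t. t \<in> {0..1} \<Longrightarrow> (f has_real_derivative f' t) (at t within {0..1})"
    and cont: "continuous_on {0..1} f'" and "\<delta> > 0"
  shows "\<forall>\<^sub>F n in sequentially. \<forall>k<n.
    \<bar>f (Suc k / n) - f (k / n) - f' (k / n) / n\<bar> \<le> \<delta> / n"
proof -
  have "uniformly_continuous_on {0..1} f'"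
    using cont by (intro compact_uniformly_continuous) auto
  then obtain d where d: "d > 0"
    "\<And>s t. s \<in> {0..1} \<Longrightarrow> t \<in> {0..1} \<Longrightarrow> dist s t < d \<Longrightarrow> dist (f' s) (f' t) < \<delta>"
    using \<open>\<delta> > 0\<close> unfolding uniformly_continuous_on_def by metis
  have "\<forall>\<^sub>F n in sequentially. 1 / real n < d"
    using d(1) by (intro order_tendstoD[OF lim_1_over_n])
  then show ?thesis
    using eventually_gt_at_top[of 0]
  proof eventually_elim
    case (elim n)
    show ?case
    proof (intro allI impI)
      fix k assume k: "k < n"
      define a b where "a = real k / n" and "b = real (Suc k) / n"
      have ab: "0 \<le> a" "a < b" "b \<le> 1" "b - a = 1 / n"
        using k by (auto simp: a_def b_def field_simps)
      have "\<exists>x\<in>{a<..<b}. f b - f a = f' x * (b - a)"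
      proof (rule mvt_simple[OF ab(2)])
        fix x assume "a \<le> x" "x \<le> b"
        then have "(f has_real_derivative f' x) (at x within {a..b})"
          using ab by (intro DERIV_subset[OF der]) auto
        then show "(f has_derivative (*) (f' x)) (at x within {a..b})"
          by (simp add: has_field_derivative_def)
      qed
      then obtain x where x: "a < x" "x < b" "f b - f a = f' x / n"
        using ab(4) by auto
      have "dist (f' x) (f' a) < \<delta>"
        using x ab elim by (intro d) (auto simp: dist_real_def)
      then have "\<bar>f' x - f' a\<bar> / n \<le> \<delta> / n"
        by (intro divide_right_mono) (auto simp: dist_real_def)
      then show "\<bar>f (Suc k / n) - f (k / n) - f' (k / n) / n\<bar> \<le> \<delta> / n"
        using x(3) by (simp add: a_def b_def diff_divide_distrib[symmetric])
    qed
  qed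
qed

text \<open>Stability plus consistency. The error on the grid obeys the recursion of
  \<open>v\<close> itself, forced by the Taylor error of \<open>m\<close> and by the deviation of
  the coefficients from \<open>1 + A / n\<close>, both o(1/n) uniformly in k. Absolute row sums of
  at most \<open>1 + L / n\<close> keep the amplification over n steps below \<open>exp L\<close>.
  Only orders \<open>p - j\<close> occur, so the orders up to \<open>P\<close> form a closed
  system.\<close>

lemma euler_scheme_tendsto:
  fixes v :: "nat \<Rightarrow> nat \<Rightarrow> nat \<Rightarrow> real" and c :: "nat \<Rightarrow> nat \<Rightarrow> nat \<Rightarrow> real"
    and A :: "nat \<Rightarrow> nat \<Rightarrow> real" and m :: "nat \<Rightarrow> real \<Rightarrow> real"
  assumes init: "\<And>n p. p \<le> P \<Longrightarrow> v n 0 p = m p 0"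
    and step: "\<And>n k p. n \<ge> 1 \<Longrightarrow> k < n \<Longrightarrow> p \<le> P \<Longrightarrow> v n (Suc k) p = (\<Sum>j\<le>p. c n p j * v n k (p - j))"
    and lim: "\<And>p j. p \<le> P \<Longrightarrow> j \<le> p \<Longrightarrow> (\<lambda>n. real n * (c n p j - (if j = 0 then 1 else 0))) \<longlonglongrightarrow> A p j"
    and der: "\<And>p t. p \<le> P \<Longrightarrow> t \<in> {0..1} \<Longrightarrow>
       (m p has_real_derivative (\<Sum>j\<le>p. A p j * m (p - j) t)) (at t within {0..1})"
    and p: "p \<le> P"
  shows "(\<lambda>n. v n n p) \<longlonglongrightarrow> m p 1"
proof (rule tendstoI)
  fix \<epsilon> :: real assume \<epsilon>: "\<epsilon> > 0"
  have cont: "continuous_on {0..1} (m p)" if "p \<le> P" for p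
    using der[OF that] by (meson DERIV_continuous continuous_on_eq_continuous_within)
  have "\<exists>K>0. \<forall>p\<le>P. \<forall>t\<in>{0..1}. \<bar>m p t\<bar> \<le> K"
  proof -
    have "\<exists>K. \<forall>t\<in>{0..1}. \<bar>m p t\<bar> \<le> K" if "p \<le> P" for p
      using compact_imp_bounded[OF compact_continuous_image[OF cont[OF that] compact_Icc]]
      by (auto simp: bounded_iff)
    then obtain K where K: "\<And>p t. p \<le> P \<Longrightarrow> t \<in> {0..1} \<Longrightarrow> \<bar>m p t\<bar> \<le> K p" by metis
    have "\<bar>m p t\<bar> \<le> 1 + (\<Sum>p\<le>P. \<bar>K p\<bar>)" if "p \<le> P" "t \<in> {0..1}" for p t
      using K[OF that] member_le_sum[of p "{..P}" "\<lambda>p. \<bar>K p\<bar>"] that(1) by force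
    moreover have "0 < 1 + (\<Sum>p\<le>P. \<bar>K p\<bar>)" by (simp add: add_pos_nonneg sum_nonneg)
    ultimately show ?thesis by blast
  qed
  then obtain K where K: "K > 0" "\<And>p t. p \<le> P \<Longrightarrow> t \<in> {0..1} \<Longrightarrow> \<bar>m p t\<bar> \<le> K" by blast
  \<comment> \<open>The summand 1 absorbs the deviations \<open>r n p j\<close>, which are kept
    below \<open>\<eta> \<le> 1\<close>; so \<open>L\<close> does not depend on n.\<close>
  define L where "L = (\<Sum>p\<le>P. \<Sum>j\<le>p. \<bar>A p j\<bar> + 1)"
  have L0: "L \<ge> 0" unfolding L_def by (intro sum_nonneg) auto
  have Lp: "(\<Sum>j\<le>p. \<bar>A p j\<bar> + 1) \<le> L" if "p \<le> P" for p
    unfolding L_def using that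
    by (intro member_le_sum[of p "{..P}" "\<lambda>p. \<Sum>j\<le>p. \<bar>A p j\<bar> + 1"]) (auto intro!: sum_nonneg)
  \<comment> \<open>The factor 2 turns the final bound \<open>\<delta> * exp L\<close> into
    \<open>\<epsilon> / 2\<close>. One half of \<open>\<delta>\<close> pays for the Taylor error,
    the other for the at most \<open>P + 1\<close> coefficient errors of size
    \<open>\<eta> * K\<close>.\<close>
  define \<delta> where "\<delta> = \<epsilon> / (2 * exp L)"
  have \<delta>: "\<delta> > 0" using \<epsilon> by (simp add: \<delta>_def)
  define \<eta> where "\<eta> = min 1 (\<delta> / (2 * K * (real P + 1)))"
  have \<eta>: "\<eta> > 0" "\<eta> \<le> 1" "(real P + 1) * \<eta> * K \<le> \<delta> / 2"
  proof -
    show "\<eta> > 0" "\<eta> \<le> 1" using \<delta> K by (auto simp: \<eta>_def)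
    have "(real P + 1) * \<eta> * K \<le> (real P + 1) * (\<delta> / (2 * K * (real P + 1))) * K"
      using K by (intro mult_right_mono mult_left_mono) (auto simp: \<eta>_def)
    also have "\<dots> = \<delta> / 2"
    proof -
      have "a * (\<delta> / (2 * K * a)) * K = \<delta> / 2" if "a > 0" for a
        using K(1) that by (simp add: field_simps)
      then show ?thesis by this simp
    qed
    finally show "(real P + 1) * \<eta> * K \<le> \<delta> / 2" .
  qed
  define r where "r n p j = n * (c n p j - (if j = 0 then 1 else 0)) - A p j" for n p j
  have "\<forall>\<^sub>F n in sequentially. \<forall>p\<in>{..P}. \<forall>j\<in>{..p}. \<bar>r n p j\<bar> < \<eta>"
  proof (intro eventually_ball_finite ballI)
    fix p j assume "p \<in> {..P}" "j \<in> {..p}"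
    then show "\<forall>\<^sub>F n in sequentially. \<bar>r n p j\<bar> < \<eta>"
      using tendstoD[OF lim[of p j] \<eta>(1)] by (simp add: r_def dist_real_def)
  qed auto
  moreover have "\<forall>\<^sub>F n in sequentially. \<forall>p\<in>{..P}. \<forall>k<n. \<bar>m p (Suc k / n) - m p (k / n)
       - (\<Sum>j\<le>p. A p j * m (p - j) (k / n)) / n\<bar> \<le> (\<delta> / 2) / n"
    using \<delta> by (intro eventually_ball_finite ballI uniform_taylor1 der)
       (auto intro!: continuous_intros cont)
  ultimately show "\<forall>\<^sub>F n in sequentially. dist (v n n p) (m p 1) < \<epsilon>"
    using eventually_ge_at_top[of 1]
  proof eventually_elim
    case (elim n)
    have n: "n \<ge> 1" by fact
    define e where "e k p = v n k p - m p (k / n)" for k p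
    have c: "c n p j = (if j = 0 then 1 else 0) + (A p j + r n p j) / n" for p j
      using n by (simp add: r_def field_simps)
    have r: "\<bar>r n p j\<bar> \<le> \<eta>" if "p \<le> P" "j \<le> p" for p j
      using elim(1) that by (auto intro: less_imp_le)
    have "\<bar>e n p\<bar> \<le> \<delta> * exp L"
    proof (rule discrete_gronwall[OF n L0 _ _ _ p])
      show "e 0 p = 0" if "p \<le> P" for p using init[OF that] by (simp add: e_def)
    next
      fix k p and B :: real
      assume k: "k < n" and p: "p \<le> P" and B: "B \<ge> 0" "\<And>i. i \<le> P \<Longrightarrow> \<bar>e k i\<bar> \<le> B"
      define t where "t = real k / n"
      have t: "t \<in> {0..1}" using k by (simp add: t_def)
      have "e (Suc k) p = (\<Sum>j\<le>p. c n p j * (e k (p - j) + m (p - j) t)) - m p (Suc k / n)"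
        using step[OF n k p] by (simp add: e_def t_def)
      also have "\<dots> = (\<Sum>j\<le>p. c n p j * e k (p - j)) +
          ((\<Sum>j\<le>p. c n p j * m (p - j) t) - m p (Suc k / n))"
        by (simp add: algebra_simps sum.distrib)
      also have "(\<Sum>j\<le>p. c n p j * m (p - j) t) = m p t +
           (\<Sum>j\<le>p. A p j * m (p - j) t) / n + (\<Sum>j\<le>p. r n p j * m (p - j) t) / n"
      proof -
        have "(\<Sum>j\<le>p. c n p j * m (p - j) t) = (\<Sum>j\<le>p. (if j = 0 then m p t else 0)
            + (A p j * m (p - j) t) / n + r n p j * m (p - j) t / n)"
          by (intro sum.cong) (auto simp: c add_divide_distrib algebra_simps)
        then show ?thesis by (simp add: sum.distrib sum_divide_distrib)
      qed
      \<comment> \<open>Propagated error, minus the Taylor error of \<open>m\<close>, plus the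
        coefficient error; the three are bounded separately.\<close>
      finally have eq: "e (Suc k) p = (\<Sum>j\<le>p. c n p j * e k (p - j)) - (m p (Suc k / n) - m p t
           - (\<Sum>j\<le>p. A p j * m (p - j) t) / n) + (\<Sum>j\<le>p. r n p j * m (p - j) t) / n"
        by simp
      have 1: "\<bar>\<Sum>j\<le>p. c n p j * e k (p - j)\<bar> \<le> (1 + L / n) * B"
      proof -
        have "\<bar>\<Sum>j\<le>p. c n p j * e k (p - j)\<bar> \<le> (\<Sum>j\<le>p. ((if j = 0 then 1 else 0) + (\<bar>A p j\<bar> + 1) / n) * B)"
        proof (rule order.trans[OF sum_abs], rule sum_mono)
          fix j assume j: "j \<in> {..p}"
          have "\<bar>c n p j\<bar> \<le> (if j = 0 then 1 else 0) + \<bar>A p j + r n p j\<bar> / n"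
            unfolding c by (rule order.trans[OF abs_triangle_ineq]) simp
          also have "\<bar>A p j + r n p j\<bar> / n \<le> (\<bar>A p j\<bar> + 1) / n"
            using r[OF p, of j] j \<eta>(2) by (intro divide_right_mono) auto
          finally have "\<bar>c n p j\<bar> \<le> (if j = 0 then 1 else 0) + (\<bar>A p j\<bar> + 1) / n" by simp
          then show "\<bar>c n p j * e k (p - j)\<bar> \<le> ((if j = 0 then 1 else 0) + (\<bar>A p j\<bar> + 1) / n) * B"
            unfolding abs_mult using B p by (intro mult_mono) auto
        qed
        also have "\<dots> = (1 + (\<Sum>j\<le>p. \<bar>A p j\<bar> + 1) / n) * B"
          unfolding sum_distrib_right[symmetric]
          by (subst sum.distrib) (simp add: sum_divide_distrib[symmetric])
        also have "\<dots> \<le> (1 + L / n) * B"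
          using Lp[OF p] B by (intro mult_right_mono add_left_mono divide_right_mono) auto
        finally show ?thesis .
      qed
      have 2: "\<bar>m p (Suc k / n) - m p t - (\<Sum>j\<le>p. A p j * m (p - j) t) / n\<bar> \<le> (\<delta> / 2) / n"
        using elim(2) p k by (auto simp: t_def)
      have 3: "\<bar>(\<Sum>j\<le>p. r n p j * m (p - j) t) / n\<bar> \<le> (\<delta> / 2) / n"
      proof -
        have "\<bar>\<Sum>j\<le>p. r n p j * m (p - j) t\<bar> \<le> (\<Sum>j\<le>p. \<eta> * K)"
          using r[OF p] K(2)[OF _ t] p
          by (intro order.trans[OF sum_abs] sum_mono) (auto simp: abs_mult intro!: mult_mono less_imp_le[OF \<eta>(1)])
        also have "\<dots> = (real p + 1) * \<eta> * K" by simp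
        also have "\<dots> \<le> (real P + 1) * \<eta> * K"
          using p \<eta>(1) K(1) by (intro mult_right_mono) auto
        also note \<eta>(3)
        finally have "\<bar>\<Sum>j\<le>p. r n p j * m (p - j) t\<bar> / n \<le> (\<delta> / 2) / n"
          by (intro divide_right_mono) auto
        then show ?thesis by simp
      qed
      show "\<bar>e (Suc k) p\<bar> \<le> (1 + L / n) * B + \<delta> / n"
        unfolding eq using 1 2 3 by linarith
    qed (use \<delta> in simp)
    also have "\<dots> < \<epsilon>" using \<epsilon> by (simp add: \<delta>_def)
    finally show ?case using n by (simp add: e_def dist_real_def)
  qed
qed

section \<open>The linear differential equations of the moments\<close>

text \<open>The coefficient of y^(p - j) when the generator of the diffusion Y, with drift
  \<open>\<mu>\<xi> + \<kappa> * y\<close> and squared volatility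
  \<open>\<sigma>\<rho>^2 * y^2 + \<sigma>\<xi>^2\<close>, is applied to the monomial y^p. The index
  \<open>j\<close> counts by how much the order drops.\<close>

definition moment_generator :: "real \<Rightarrow> real \<Rightarrow> real \<Rightarrow> real \<Rightarrow> nat \<Rightarrow> nat \<Rightarrow> real" where
  "moment_generator \<mu>\<xi> \<sigma>\<xi> \<mu>\<rho> \<sigma>\<rho> p j =
     (if j = 0 then real p * \<mu>\<rho> + (real p)\<^sup>2 * \<sigma>\<rho>\<^sup>2 / 2
      else if j = 1 then real p * \<mu>\<xi>
      else if j = 2 then real p * (real p - 1) * \<sigma>\<xi>\<^sup>2 / 2 else 0)"

lemma mom_0: "mom y \<mu>\<xi> \<sigma>\<xi> \<mu>\<rho> \<sigma>\<rho> p 0 = y ^ p"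
  by (cases "(y, \<mu>\<xi>, \<sigma>\<xi>, \<mu>\<rho>, \<sigma>\<rho>, p, 0::real)" rule: mom.cases) (auto simp: Let_def)

lemma mom_has_derivative:
  assumes "t \<in> {0..1}"
  shows "(mom y \<mu>\<xi> \<sigma>\<xi> \<mu>\<rho> \<sigma>\<rho> p has_real_derivative
     (\<Sum>j\<le>p. moment_generator \<mu>\<xi> \<sigma>\<xi> \<mu>\<rho> \<sigma>\<rho> p j * mom y \<mu>\<xi> \<sigma>\<xi> \<mu>\<rho> \<sigma>\<rho> (p - j) t)) (at t within {0..1})"
  using assms
proof (induction p arbitrary: t rule: less_induct)
  case (less p)
  let ?m = "mom y \<mu>\<xi> \<sigma>\<xi> \<mu>\<rho> \<sigma>\<rho>"
  consider "p = 0" | "p = 1" | k where "p = Suc (Suc k)"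
    by (metis One_nat_def not0_implies_Suc)
  then show ?case
  proof cases
    case 1
    have "?m 0 = (\<lambda>_. 1)" by (rule ext) simp
    then show ?thesis using 1 by (simp add: moment_generator_def)
  next
    case 2
    define \<kappa> where "\<kappa> = \<mu>\<rho> + \<sigma>\<rho>^2 / 2"
    have m: "?m 1 = (\<lambda>t. if \<kappa> \<noteq> 0 then y * exp (\<kappa> * t) + \<mu>\<xi> / \<kappa> * (exp (\<kappa> * t) - 1) else y + \<mu>\<xi> * t)"
      by (rule ext) (simp add: \<kappa>_def Let_def)
    have s: "(\<Sum>j\<le>p. moment_generator \<mu>\<xi> \<sigma>\<xi> \<mu>\<rho> \<sigma>\<rho> p j * ?m (p - j) t) = \<kappa> * ?m 1 t + \<mu>\<xi>"
      using 2 by (simp add: moment_generator_def \<kappa>_def)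
    show ?thesis unfolding s unfolding 2 m
      by (cases "\<kappa> = 0") (auto intro!: derivative_eq_intros simp: field_simps)
  next
    case 3
    define a b c where "a = real p * \<mu>\<rho> + (real p)^2 * \<sigma>\<rho>^2 / 2"
      and "b = real p * \<mu>\<xi>" and "c = real p * (real p - 1) * \<sigma>\<xi>^2 / 2"
    define g where "g s = b * ?m (Suc k) s + c * ?m k s" for s
    \<comment> \<open>Taking \<open>exp (a * t)\<close> out of the integral removes t from the
      integrand, so the fundamental theorem of calculus and the product rule suffice. Continuity of
      the integrand comes from the induction hypothesis for the two lower orders.\<close>
    have m: "?m p = (\<lambda>t. exp (a * t) * (y ^ p + integral {0..t} (\<lambda>s. exp (- a * s) * g s)))"
    proof (rule ext)
      fix t
      have "?m p t = y ^ p * exp (a * t) + integral {0..t} (\<lambda>s. exp (a * (t - s)) * g s)"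
        unfolding 3 by (simp add: Let_def a_def b_def c_def g_def 3)
      also have "(\<lambda>s. exp (a * (t - s)) * g s) = (\<lambda>s. exp (a * t) * (exp (- a * s) * g s))"
        by (rule ext) (simp add: algebra_simps exp_add[symmetric] mult.assoc[symmetric])
      finally show "?m p t = exp (a * t) * (y ^ p + integral {0..t} (\<lambda>s. exp (- a * s) * g s))"
        unfolding Henstock_Kurzweil_Integration.integral_mult_right distrib_left by (simp only: mult.commute)
    qed
    have cont: "continuous_on {0..1} (?m j)" if "j < p" for j
      using less.IH[OF that] by (meson DERIV_continuous continuous_on_eq_continuous_within)
    have "continuous_on {0..1} (\<lambda>s. exp (- a * s) * g s)"
      unfolding g_def using 3 by (intro continuous_intros cont) auto
    from integral_has_real_derivative[OF this less.prems]
    have "(?m p has_real_derivative exp (a * t) * a * (y ^ p + integral {0..t} (\<lambda>s. exp (- a * s) * g s))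
        + exp (- a * t) * g t * exp (a * t)) (at t within {0..1})"
      unfolding m by (auto intro!: derivative_eq_intros)
    moreover have "exp (a * t) * a * (y ^ p + integral {0..t} (\<lambda>s. exp (- a * s) * g s)) = a * ?m p t"
      unfolding m by simp
    moreover have "exp (- a * t) * g t * exp (a * t) = g t"
      by (simp add: exp_minus)
    ultimately have "(?m p has_real_derivative a * ?m p t + g t) (at t within {0..1})"
      by (simp only:)
    moreover have "(\<Sum>j\<le>p. moment_generator \<mu>\<xi> \<sigma>\<xi> \<mu>\<rho> \<sigma>\<rho> p j * ?m (p - j) t) = a * ?m p t + g t"
    proof -
      have "(\<Sum>j\<le>p. moment_generator \<mu>\<xi> \<sigma>\<xi> \<mu>\<rho> \<sigma>\<rho> p j * ?m (p - j) t)
          = (\<Sum>j\<in>{0,1,2}. moment_generator \<mu>\<xi> \<sigma>\<xi> \<mu>\<rho> \<sigma>\<rho> p j * ?m (p - j) t)"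
        using 3 by (intro sum.mono_neutral_right) (auto simp: moment_generator_def)
      also have "\<dots> = a * ?m p t + g t"
        by (simp add: moment_generator_def g_def a_def b_def c_def 3 del: mom.simps)
      finally show ?thesis .
    qed
    ultimately show ?thesis by simp
  qed
qed

subsection \<open>Linear recursions with independent coefficients\<close>

fun lin_rec :: "(real \<Rightarrow> real) \<Rightarrow> (nat \<Rightarrow> 'a \<Rightarrow> real) \<Rightarrow> (nat \<Rightarrow> 'a \<Rightarrow> real) \<Rightarrow> real \<Rightarrow> nat \<Rightarrow> 'a \<Rightarrow> real" where
  "lin_rec d U V y 0 x = y"
| "lin_rec d U V y (Suc k) x = U (Suc k) x * d (V (Suc k) x) + lin_rec d U V y k x * V (Suc k) x"

text \<open>The outcome may change along with the coefficients, even its type: this lets the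
  recursion be read as a function of a vector of coordinates.\<close>

lemma lin_rec_cong:
  assumes "\<And>i. 1 \<le> i \<Longrightarrow> i \<le> k \<Longrightarrow> U i x = U' i x' \<and> V i x = V' i x'"
  shows "lin_rec d U V y k x = lin_rec d U' V' y k x'"
  using assms by (induction k) auto

lemma borel_measurable_lin_rec:
  assumes d[measurable]: "d \<in> borel_measurable borel"
    and U: "\<And>i. 1 \<le> i \<Longrightarrow> i \<le> k \<Longrightarrow> U i \<in> borel_measurable M"
    and V: "\<And>i. 1 \<le> i \<Longrightarrow> i \<le> k \<Longrightarrow> V i \<in> borel_measurable M"
  shows "lin_rec d U V y k \<in> borel_measurable M"
  using U V
proof (induction k)
  case 0
  have "lin_rec d U V y 0 = (\<lambda>_. y)" by (rule ext) simp
  then show ?case by simp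
next
  case (Suc k)
  have [measurable]: "U (Suc k) \<in> borel_measurable M" "V (Suc k) \<in> borel_measurable M"
      "lin_rec d U V y k \<in> borel_measurable M"
    using Suc by auto
  have "lin_rec d U V y (Suc k) = (\<lambda>x. U (Suc k) x * d (V (Suc k) x) + lin_rec d U V y k x * V (Suc k) x)"
    by (rule ext) simp
  then show ?case by simp
qed

context prob_space
begin

text \<open>The state after \<open>k\<close> steps is a measurable function of the coefficients with
  index at most \<open>k\<close>. Splitting the independent family into this block and the two
  singletons of index \<open>Suc k\<close> gives three independent variables, coded as a family over
  {0, 1, 2}.\<close>

lemma indep_lin_rec:
  assumes indep: "indep_vars (\<lambda>_. borel) (case_sum U V) (Inl ` {1..n} \<union> Inr ` {1..n})"
    and d: "d \<in> borel_measurable borel" and k: "k < n"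
  shows "indep_vars (\<lambda>_::nat. borel)
     (\<lambda>i. if i = 0 then lin_rec d U V y k else if i = 1 then U (Suc k) else V (Suc k)) {0, 1, 2}"
proof -
  let ?X = "case_sum U V"
  define K :: "nat \<Rightarrow> (nat + nat) set" where
    "K i = (if i = 0 then Inl ` {1..k} \<union> Inr ` {1..k} else if i = 1 then {Inl (Suc k)} else {Inr (Suc k)})" for i
  define F :: "nat \<Rightarrow> (nat + nat \<Rightarrow> real) \<Rightarrow> real" where
    "F i = (if i = 0 then lin_rec d (\<lambda>j f. f (Inl j)) (\<lambda>j f. f (Inr j)) y k
       else if i = 1 then (\<lambda>f. f (Inl (Suc k))) else (\<lambda>f. f (Inr (Suc k))))" for i
  have "indep_vars (\<lambda>i. PiM (K i) (\<lambda>_. borel)) (\<lambda>i x. restrict (\<lambda>j. ?X j x) (K i)) {0, 1, 2}"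
    using k by (intro indep_vars_restrict[OF indep]) (auto simp: K_def disjoint_family_on_def)
  then have "indep_vars (\<lambda>_. borel) (\<lambda>i x. F i (restrict (\<lambda>j. ?X j x) (K i))) {0, 1, 2}"
  proof (rule indep_vars_compose2)
    fix i :: nat assume "i \<in> {0, 1, 2}"
    then show "F i \<in> borel_measurable (PiM (K i) (\<lambda>_. borel))"
      by (auto simp: F_def K_def intro!: borel_measurable_lin_rec d measurable_component_singleton)
  qed
  also have "?this \<longleftrightarrow> ?thesis"
  proof (intro indep_vars_cong refl ext)
    fix i :: nat and x assume "i \<in> {0, 1, 2}"
    then show "F i (restrict (\<lambda>j. ?X j x) (K i)) =
        (if i = 0 then lin_rec d U V y k else if i = 1 then U (Suc k) else V (Suc k)) x"
      by (auto simp: F_def K_def intro!: lin_rec_cong)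
  qed
  finally show ?thesis .
qed

text \<open>Binomial expansion and independence of state and new coefficients. The powers of
  \<open>d (V k x)\<close> and \<open>V k x\<close> depend on the same variable, so their joint
  moment \<open>w j i\<close> cannot be split. Since \<open>u\<close> and \<open>w\<close> do not
  depend on k, the matrix of the resulting recursion is the same in every step.\<close>

lemma lin_rec_moments:
  assumes indep: "indep_vars (\<lambda>_. borel) (case_sum U V) (Inl ` {1..n} \<union> Inr ` {1..n})"
    and d[measurable]: "d \<in> borel_measurable borel"
    and U: "\<And>k j. k \<in> {1..n} \<Longrightarrow> j \<le> P \<Longrightarrow> has_bochner_integral M (\<lambda>x. U k x ^ j) (u j)"
    and V: "\<And>k i j. k \<in> {1..n} \<Longrightarrow> j + i \<le> P \<Longrightarrow>
        has_bochner_integral M (\<lambda>x. d (V k x) ^ j * V k x ^ i) (w j i)"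
  shows lin_rec_moment_integrable:
      "k \<le> n \<Longrightarrow> p \<le> P \<Longrightarrow> integrable M (\<lambda>x. lin_rec d U V y k x ^ p)"
    and lin_rec_moment_Suc: "k < n \<Longrightarrow> p \<le> P \<Longrightarrow> expectation (\<lambda>x. lin_rec d U V y (Suc k) x ^ p) =
      (\<Sum>j\<le>p. of_nat (p choose j) * u j * w j (p - j) * expectation (\<lambda>x. lin_rec d U V y k x ^ (p - j)))"
proof -
  let ?T = "lin_rec d U V y"
  have product: "has_bochner_integral M
       (\<lambda>x. ?T k x ^ i * U (Suc k) x ^ j * (d (V (Suc k) x) ^ j * V (Suc k) x ^ i))
       (expectation (\<lambda>x. ?T k x ^ i) * u j * w j i)"
    if "k < n" "j + i \<le> P" and int: "integrable M (\<lambda>x. ?T k x ^ i)" for k i j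
  proof -
    define G :: "nat \<Rightarrow> real \<Rightarrow> real" where
      "G l = (if l = 0 then (\<lambda>z. z ^ i) else if l = 1 then (\<lambda>z. z ^ j) else (\<lambda>z. d z ^ j * z ^ i))" for l
    define X :: "nat \<Rightarrow> 'a \<Rightarrow> real" where
      "X l = (if l = 0 then ?T k else if l = 1 then U (Suc k) else V (Suc k))" for l
    have "indep_vars (\<lambda>_. borel) X {0, 1, 2}"
      unfolding X_def by (rule indep_lin_rec[OF indep d \<open>k < n\<close>])
    then have ind: "indep_vars (\<lambda>_. borel) (\<lambda>l x. G l (X l x)) {0, 1, 2}"
      by (rule indep_vars_compose2) (auto simp: G_def)
    have hU: "has_bochner_integral M (\<lambda>x. U (Suc k) x ^ j) (u j)"
      and hV: "has_bochner_integral M (\<lambda>x. d (V (Suc k) x) ^ j * V (Suc k) x ^ i) (w j i)"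
      using that by (auto intro!: U V)
    have int': "integrable M (\<lambda>x. G l (X l x))" if "l \<in> {0, 1, 2}" for l
      using that int hU hV by (auto simp: G_def X_def has_bochner_integral_iff)
    have p: "(\<Prod>l\<in>{0, 1, 2}. G l (X l x)) =
       ?T k x ^ i * U (Suc k) x ^ j * (d (V (Suc k) x) ^ j * V (Suc k) x ^ i)" for x
      by (simp add: G_def X_def)
    have q: "(\<Prod>l\<in>{0, 1, 2}. expectation (\<lambda>x. G l (X l x))) = expectation (\<lambda>x. ?T k x ^ i) * u j * w j i"
      using hU hV by (simp add: G_def X_def has_bochner_integral_iff)
    show ?thesis
      using indep_vars_integrable[OF _ ind int'] indep_vars_lebesgue_integral[OF _ ind int']
      unfolding p q by (simp add: has_bochner_integral_iff)
  qed
  have step: "has_bochner_integral M (\<lambda>x. ?T (Suc k) x ^ p)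
      (\<Sum>j\<le>p. of_nat (p choose j) * u j * w j (p - j) * expectation (\<lambda>x. ?T k x ^ (p - j)))"
    if "k < n" "p \<le> P" and int: "\<And>i. i \<le> P \<Longrightarrow> integrable M (\<lambda>x. ?T k x ^ i)" for k p
  proof -
    have "?T (Suc k) x ^ p = (\<Sum>j\<le>p. of_nat (p choose j) *
       (?T k x ^ (p - j) * U (Suc k) x ^ j * (d (V (Suc k) x) ^ j * V (Suc k) x ^ (p - j))))" for x
      unfolding lin_rec.simps binomial_ring by (simp add: power_mult_distrib mult_ac)
    moreover have "of_nat (p choose j) * u j * w j (p - j) * expectation (\<lambda>x. ?T k x ^ (p - j))
        = of_nat (p choose j) * (expectation (\<lambda>x. ?T k x ^ (p - j)) * u j * w j (p - j))" for j
      by simp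
    ultimately show ?thesis
      using that by (simp only:) (intro has_bochner_integral_sum has_bochner_integral_mult_right product, auto)
  qed
  have int: "k \<le> n \<Longrightarrow> p \<le> P \<Longrightarrow> integrable M (\<lambda>x. ?T k x ^ p)" for k p
  proof (induction k arbitrary: p)
    case (Suc k)
    then show ?case
      using step[of k p] by (auto simp: has_bochner_integral_iff simp del: lin_rec.simps)
  qed simp
  then show "k \<le> n \<Longrightarrow> p \<le> P \<Longrightarrow> integrable M (\<lambda>x. ?T k x ^ p)" .
  show "expectation (\<lambda>x. ?T (Suc k) x ^ p) =
      (\<Sum>j\<le>p. of_nat (p choose j) * u j * w j (p - j) * expectation (\<lambda>x. ?T k x ^ (p - j)))"
    if "k < n" "p \<le> P"
    using step[of k p] that int[of k] by (auto simp: has_bochner_integral_iff simp del: lin_rec.simps)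
qed

end

subsection \<open>Asymptotics of the one-step moments\<close>

lemma exp_remainder_nonneg: "0 \<le> exp x - 1 - x" for x :: real
  using exp_ge_add_one_self[of x] by linarith

text \<open>The quadratic lower Taylor bound at -x is inverted: the Taylor polynomials at x and -x
  multiply to 1 + x^4 / 4, which is at least 1.\<close>

lemma exp_remainder_le_neg:
  fixes x :: real
  assumes "x \<le> 0" shows "exp x - 1 - x \<le> x\<^sup>2 / 2"
proof -
  have "1 + (-x) + (-x)\<^sup>2 / 2 \<le> exp (- x)"
    using assms by (intro exp_lower_Taylor_quadratic) auto
  moreover have "0 < 1 + (-x) + (-x)\<^sup>2 / 2" using assms by (simp add: add_pos_nonneg)
  ultimately have "exp x \<le> inverse (1 + (-x) + (-x)\<^sup>2 / 2)"
    by (metis exp_minus inverse_inverse_eq le_imp_inverse_le)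
  also have "\<dots> \<le> 1 + x + x\<^sup>2 / 2"
  proof -
    have "1 \<le> (1 + x + x\<^sup>2 / 2) * (1 + (-x) + (-x)\<^sup>2 / 2)"
    proof -
      have "(1 + x + x\<^sup>2 / 2) * (1 + (-x) + (-x)\<^sup>2 / 2) = 1 + x ^ 4 / 4"
        by (simp add: power2_eq_square power4_eq_xxxx algebra_simps)
      then show ?thesis by simp
    qed
    then show ?thesis using \<open>0 < 1 + (-x) + (-x)\<^sup>2 / 2\<close> by (simp add: inverse_eq_divide divide_le_eq)
  qed
  finally show ?thesis by simp
qed

lemma exp_remainder_le_pos:
  fixes x :: real
  assumes "x \<ge> 0" shows "exp x - 1 - x \<le> x\<^sup>2 / 2 * exp x"
proof -
  obtain t where t: "\<bar>t\<bar> \<le> \<bar>x\<bar>" "exp x = (\<Sum>m<2. x ^ m / fact m) + exp t / fact 2 * x ^ 2"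
    using Maclaurin_exp_le[of x 2] by blast
  have "exp x - 1 - x = x\<^sup>2 / 2 * exp t" using t(2) by (simp add: numeral_2_eq_2 field_simps)
  also have "\<dots> \<le> x\<^sup>2 / 2 * exp x" using t(1) assms by (intro mult_left_mono) auto
  finally show ?thesis .
qed

text \<open>Since \<open>r < 1\<close>, the remainder at \<open>r u\<close> is negligible against the one at \<open>u\<close> for large \<open>u\<close>.\<close>
lemma exp_remainder_scaled_le:
  fixes r \<delta> :: real
  assumes r: "0 \<le> r" "r < 1" and \<delta>: "\<delta> > 0"
  obtains C where "C \<ge> 1" "\<And>u. exp (r * u) - 1 - r * u \<le> \<delta> * (exp u - 1 - u) + C * u\<^sup>2"
proof -
  have "\<forall>\<^sub>F u in at_top. exp (r * u) \<le> \<delta> * (exp u - 1 - u)"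
  proof (cases "r = 0")
    case True
    have "\<forall>\<^sub>F u in at_top. 1 \<le> \<delta> * (exp u - 1 - u)" using \<delta> by real_asymp
    then show ?thesis using True by simp
  next
    case False
    then have "r > 0" using r by simp
    then show ?thesis using r(2) \<delta> by real_asymp
  qed
  then obtain K where K: "\<And>u. u \<ge> K \<Longrightarrow> exp (r * u) \<le> \<delta> * (exp u - 1 - u)"
    by (auto simp: eventually_at_top_linorder)
  have "exp (r * u) - 1 - r * u \<le> \<delta> * (exp u - 1 - u) + exp \<bar>K\<bar> * u\<^sup>2" for u
  proof -
    have ru: "(r * u)\<^sup>2 \<le> u\<^sup>2"
      using r by (auto simp: power_mult_distrib intro!: mult_left_le_one_le power_le_one)
    have nn: "0 \<le> \<delta> * (exp u - 1 - u)" using exp_remainder_nonneg[of u] \<delta> by simp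
    \<comment> \<open>For negative u the remainder is at most quadratic; up to
      \<open>\<bar>K\<bar>\<close> the exponential is at most \<open>exp \<bar>K\<bar>\<close>,
      which supplies the constant; beyond \<open>K\<close> the remainder at u dominates.\<close>
    consider "u \<le> 0" | "0 \<le> u" "u \<le> \<bar>K\<bar>" | "0 \<le> u" "K \<le> u" by linarith
    then show ?thesis
    proof cases
      case 1
      have "exp (r * u) - 1 - r * u \<le> (r * u)\<^sup>2 / 2"
        using 1 r by (intro exp_remainder_le_neg) (simp add: mult_nonneg_nonpos)
      also have "\<dots> \<le> 1 * u\<^sup>2" using ru zero_le_power2[of u] by linarith
      also have "\<dots> \<le> exp \<bar>K\<bar> * u\<^sup>2" by (intro mult_right_mono) auto
      finally show ?thesis using nn by linarith
    next
      case 2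
      have "exp (r * u) - 1 - r * u \<le> (r * u)\<^sup>2 / 2 * exp (r * u)"
        using 2 r by (intro exp_remainder_le_pos) simp
      also have "\<dots> \<le> u\<^sup>2 * exp \<bar>K\<bar>"
      proof (intro mult_mono)
        have "r * u \<le> 1 * u" using r 2 by (intro mult_right_mono) auto
        then show "exp (r * u) \<le> exp \<bar>K\<bar>" using 2 by simp
        show "(r * u)\<^sup>2 / 2 \<le> u\<^sup>2" using ru zero_le_power2[of u] by linarith
      qed auto
      finally show ?thesis using nn by (simp add: mult.commute)
    next
      case 3
      have "exp (r * u) - 1 - r * u \<le> exp (r * u)"
        using mult_nonneg_nonneg[OF r(1) 3(1)] by linarith
      also have "\<dots> \<le> \<delta> * (exp u - 1 - u)" by (rule K) fact
      finally show ?thesis by (smt (verit) exp_gt_zero mult_nonneg_nonneg zero_le_power2)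
    qed
  qed
  then show ?thesis by (intro that[of "exp \<bar>K\<bar>"]) auto
qed

lemma exp_remainder_scaled_tendsto:
  "(\<lambda>n. real n * (exp (x / sqrt (real n)) - 1 - x / sqrt (real n))) \<longlonglongrightarrow> x\<^sup>2 / 2" for x :: real
  unfolding power2_eq_square by real_asymp

lemma scaled_exp_tendsto: "(\<lambda>n. real n * (exp (x / real n) - 1)) \<longlonglongrightarrow> x" for x :: real
  by real_asymp

section \<open>Exponential moments of rescaled centred variables\<close>

lemma (in prob_space) integrable_exp_smaller:
  fixes Z :: "'a \<Rightarrow> real"
  assumes [measurable]: "Z \<in> borel_measurable M"
    and int: "integrable M (\<lambda>x. exp (q * Z x))" and m: "0 \<le> m" "m \<le> q"
  shows "integrable M (\<lambda>x. exp (m * Z x))"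
proof (rule Bochner_Integration.integrable_bound)
  show "integrable M (\<lambda>x. 1 + exp (q * Z x))" using int by simp
  have "exp (m * z) \<le> 1 + exp (q * z)" for z
  proof (cases "z \<ge> 0")
    case True
    then have "exp (m * z) \<le> exp (q * z)" using m by (simp add: mult_right_mono)
    then show ?thesis by linarith
  next
    case False
    then have "m * z \<le> 0" using m by (simp add: mult_nonneg_nonpos)
    then have "exp (m * z) \<le> 1" by simp
    then show ?thesis using exp_gt_zero[of "q * z"] by linarith
  qed
  then show "AE x in M. norm (exp (m * Z x)) \<le> norm (1 + exp (q * Z x))" by auto
qed auto

text \<open>Truncating the rescaled remainder at a multiple of \<open>Z\<^sup>2\<close> makes dominated convergence applicable;
  the bound at the larger exponent \<open>q\<close> controls the part cut off.\<close>
lemma (in prob_space) exp_moment_second_order: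
  fixes Z :: "'a \<Rightarrow> real"
  assumes Z[measurable]: "Z \<in> borel_measurable M" and Z2: "integrable M (\<lambda>x. (Z x)\<^sup>2)"
    and Z0: "expectation Z = 0" and m: "0 \<le> m" "m < q"
    and int: "\<And>n. n \<ge> 1 \<Longrightarrow> integrable M (\<lambda>x. exp (q * (Z x / sqrt (real n))))"
    and bound: "\<And>n. n \<ge> 1 \<Longrightarrow> real n * (expectation (\<lambda>x. exp (q * (Z x / sqrt (real n)))) - 1) \<le> C"
  shows "(\<lambda>n. real n * (expectation (\<lambda>x. exp (m * (Z x / sqrt (real n)))) - 1))
     \<longlonglongrightarrow> m\<^sup>2 * expectation (\<lambda>x. (Z x)\<^sup>2) / 2"
proof (rule tendstoI)
  fix \<epsilon> :: real assume \<epsilon>: "\<epsilon> > 0"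
  have Z1: "integrable M Z" using square_integrable_imp_integrable[OF Z Z2] .
  \<comment> \<open>The subtracted linear term grows like sqrt n pointwise after multiplication by
    n, but costs nothing in expectation because \<open>Z\<close> is centred. What is left is
    nonnegative and converges pointwise.\<close>
  define f where "f s n x = real n * (exp (s * (Z x / sqrt n)) - 1 - s * (Z x / sqrt n))" for s n x
  have f0: "0 \<le> f s n x" for s n x unfolding f_def by (intro mult_nonneg_nonneg exp_remainder_nonneg) auto
  have f_int: "integrable M (f s n)" and f_exp: "expectation (f s n) = n * (expectation (\<lambda>x. exp (s * (Z x / sqrt n))) - 1)"
    if "n \<ge> 1" "0 \<le> s" "s \<le> q" for s n
  proof -
    have *: "integrable M (\<lambda>x. exp (s * (Z x / sqrt n)))"
      using int[OF that(1)] by (rule integrable_exp_smaller[rotated]) (use that in auto)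
    then show "integrable M (f s n)" using Z1 unfolding f_def by auto
    show "expectation (f s n) = n * (expectation (\<lambda>x. exp (s * (Z x / sqrt n))) - 1)"
      using * Z1 Z0 prob_space unfolding f_def by simp
  qed
  have C0: "0 \<le> C"
  proof -
    have "0 \<le> expectation (f q 1)" using f0 by (intro integral_nonneg_AE) auto
    also have "\<dots> \<le> C" using f_exp[of 1 q] bound[of 1] m by simp
    finally show ?thesis .
  qed
  \<comment> \<open>The summand 1 guards against \<open>C = 0\<close>. The part cut off will cost
    less than three quarters of \<open>\<epsilon>\<close>, the truncated part less than one
    quarter.\<close>
  define \<delta> where "\<delta> = \<epsilon> / 2 / (C + 1)"
  have \<delta>: "\<delta> > 0" "\<delta> * C < \<epsilon> / 2 + \<epsilon> / 4"
  proof -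
    show "\<delta> > 0" using \<epsilon> C0 by (simp add: \<delta>_def)
    have "\<delta> * C \<le> \<delta> * (C + 1)" using \<open>\<delta> > 0\<close> by simp
    also have "\<dots> = \<epsilon> / 2"
      using C0 by (intro nonzero_eq_divide_eq[THEN iffD1, OF _ \<delta>_def]) simp
    finally show "\<delta> * C < \<epsilon> / 2 + \<epsilon> / 4" using \<epsilon> by linarith
  qed
  obtain B where B: "B \<ge> 1" "\<And>u. exp (m / q * u) - 1 - m / q * u \<le> \<delta> * (exp u - 1 - u) + B * u\<^sup>2"
    using exp_remainder_scaled_le[of "m / q" \<delta>] m \<delta>(1) by auto
  \<comment> \<open>\<open>B * q^2\<close> is the quadratic term of the scaled inequality at
    \<open>u = q * Z x / sqrt n\<close>. The summand \<open>m^2\<close> keeps the truncation level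
    above the pointwise limit \<open>m^2 * (Z x)^2 / 2\<close>, so truncating does not alter that
    limit.\<close>
  define D where "D = B * q\<^sup>2 + m\<^sup>2"
  define h where "h n x = min (f m n x) (D * (Z x)\<^sup>2)" for n x
  have [measurable]: "f s n \<in> borel_measurable M" for s n unfolding f_def by measurable
  have [measurable]: "h n \<in> borel_measurable M" for n unfolding h_def by measurable
  have D0: "0 \<le> D" using B(1) by (simp add: D_def)
  have h_bound: "norm (h n x) \<le> D * (Z x)\<^sup>2" for n x
    using f0[of m n x] mult_nonneg_nonneg[OF D0 zero_le_power2[of "Z x"]] by (auto simp: h_def)
  have h_int: "integrable M (h n)" for n
    by (rule Bochner_Integration.integrable_bound[OF integrable_mult_right[OF Z2, of D]])
       (use h_bound D0 in auto)
  have "(\<lambda>n. expectation (h n)) \<longlonglongrightarrow> expectation (\<lambda>x. m\<^sup>2 * (Z x)\<^sup>2 / 2)"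
  proof (rule integral_dominated_convergence[where w = "\<lambda>x. D * (Z x)\<^sup>2"])
    show "AE x in M. (\<lambda>n. h n x) \<longlonglongrightarrow> m\<^sup>2 * (Z x)\<^sup>2 / 2"
    proof (rule AE_I2)
      fix x
      have "(\<lambda>n. f m n x) \<longlonglongrightarrow> m\<^sup>2 * (Z x)\<^sup>2 / 2"
        using exp_remainder_scaled_tendsto[of "m * Z x"] by (simp add: f_def power_mult_distrib)
      then have "(\<lambda>n. h n x) \<longlonglongrightarrow> min (m\<^sup>2 * (Z x)\<^sup>2 / 2) (D * (Z x)\<^sup>2)"
        unfolding h_def by (intro tendsto_min tendsto_const)
      moreover have "m\<^sup>2 / 2 * (Z x)\<^sup>2 \<le> D * (Z x)\<^sup>2"
      proof (rule mult_right_mono)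
        have "0 \<le> B * q\<^sup>2" using B(1) by simp
        then show "m\<^sup>2 / 2 \<le> D" unfolding D_def using zero_le_power2[of m] by linarith
      qed simp
      ultimately show "(\<lambda>n. h n x) \<longlonglongrightarrow> m\<^sup>2 * (Z x)\<^sup>2 / 2" by (simp add: min_def)
    qed
  qed (use Z2 h_bound in auto)
  then have "(\<lambda>n. expectation (h n)) \<longlonglongrightarrow> m\<^sup>2 * expectation (\<lambda>x. (Z x)\<^sup>2) / 2" by simp
  from tendstoD[OF this, of "\<epsilon> / 4"] \<epsilon>
  have "\<forall>\<^sub>F n in sequentially. dist (expectation (h n)) (m\<^sup>2 * expectation (\<lambda>x. (Z x)\<^sup>2) / 2) < \<epsilon> / 4"
    by simp
  then show "\<forall>\<^sub>F n in sequentially. dist (n * (expectation (\<lambda>x. exp (m * (Z x / sqrt n))) - 1))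
       (m\<^sup>2 * expectation (\<lambda>x. (Z x)\<^sup>2) / 2) < \<epsilon>"
    using eventually_ge_at_top[of 1]
  proof eventually_elim
    case (elim n)
    have n: "n \<ge> 1" by fact
    \<comment> \<open>Where the truncation is active, \<open>D * (Z x)^2\<close> already pays for
      the quadratic term of the scaled inequality; only its \<open>\<delta>\<close> part
      remains.\<close>
    have fh: "f m n x - h n x \<le> \<delta> * f q n x" for x
    proof -
      have "f m n x \<le> n * (\<delta> * (exp (q * (Z x / sqrt n)) - 1 - q * (Z x / sqrt n)) + B * (q * (Z x / sqrt n))\<^sup>2)"
        unfolding f_def using B(2)[of "q * (Z x / sqrt n)"] m by (intro mult_left_mono) auto
      also have "\<dots> = \<delta> * f q n x + B * q\<^sup>2 * (Z x)\<^sup>2"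
        using n by (simp add: f_def power_mult_distrib power_divide algebra_simps)
      also have "B * q\<^sup>2 * (Z x)\<^sup>2 \<le> D * (Z x)\<^sup>2" by (intro mult_right_mono) (auto simp: D_def)
      finally show ?thesis
        using mult_nonneg_nonneg[of \<delta> "f q n x"] \<delta>(1) f0[of q n x] by (auto simp: h_def min_def)
    qed
    have "expectation (f m n) - expectation (h n) = expectation (\<lambda>x. f m n x - h n x)"
      using f_int[OF n, of m] m h_int by simp
    also have "\<dots> \<le> expectation (\<lambda>x. \<delta> * f q n x)"
      using f_int[OF n, of m] f_int[OF n, of q] m h_int fh by (intro integral_mono) auto
    also have "\<dots> \<le> \<delta> * C"
      using f_exp[OF n, of q] bound[OF n] m \<delta>(1) by simp
    finally have 1: "expectation (f m n) - expectation (h n) \<le> \<delta> * C" .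
    have 2: "expectation (h n) \<le> expectation (f m n)"
      using f_int[OF n, of m] m h_int by (intro integral_mono) (auto simp: h_def)
    show ?case
      using 1 2 elim(1) \<delta>(2) f_exp[OF n, of m] m by (auto simp: dist_real_def abs_if split: if_splits)
  qed
qed

text \<open>Bernoulli's inequality turns the bound on n-th powers into the bound on
  \<open>n * (E q n - 1)\<close> that the second-order expansion asks for. The drift only multiplies
  the expectation by \<open>exp (m * \<mu> / n)\<close>, which contributes the term
  \<open>m * \<mu>\<close>.\<close>

lemma (in prob_space) exp_moment_first_order:
  fixes Z :: "'a \<Rightarrow> real"
  assumes Z[measurable]: "Z \<in> borel_measurable M" and Z2: "integrable M (\<lambda>x. (Z x)\<^sup>2)"
    and Z0: "expectation Z = 0" and m: "0 \<le> m" "m < q"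
    and int: "\<And>n. n \<ge> 1 \<Longrightarrow> integrable M (\<lambda>x. exp (q * (\<mu> / real n + Z x / sqrt (real n))))"
    and bound: "\<And>n. n \<ge> 1 \<Longrightarrow> expectation (\<lambda>x. exp (q * (\<mu> / real n + Z x / sqrt (real n)))) ^ n \<le> C"
  shows exp_moment_integrable: "n \<ge> 1 \<Longrightarrow> integrable M (\<lambda>x. exp (m * (\<mu> / real n + Z x / sqrt (real n))))"
    and exp_moment_tendsto: "(\<lambda>n. real n * (expectation (\<lambda>x. exp (m * (\<mu> / real n + Z x / sqrt (real n)))) - 1))
     \<longlonglongrightarrow> m * \<mu> + m\<^sup>2 * expectation (\<lambda>x. (Z x)\<^sup>2) / 2"
proof -
  define E where "E s n = expectation (\<lambda>x. exp (s * (Z x / sqrt (real n))))" for s n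
  have split: "exp (s * (\<mu> / real n + Z x / sqrt (real n))) = exp (s * \<mu> / n) * exp (s * (Z x / sqrt n))" for s n x
    by (simp add: exp_add[symmetric] algebra_simps)
  have int': "integrable M (\<lambda>x. exp (q * (Z x / sqrt (real n))))" if "n \<ge> 1" for n
    using int[OF that] unfolding split by simp
  have "real n * (E q n - 1) \<le> exp (- q * \<mu>) * C" if n: "n \<ge> 1" for n
  proof -
    have E0: "E q n \<ge> 0" unfolding E_def by simp
    have "1 + real n * (E q n - 1) \<le> (1 + (E q n - 1)) ^ n"
      using E0 by (intro Bernoulli_inequality) auto
    \<comment> \<open>The n-th power of the drift factor is \<open>exp (q * \<mu>)\<close> for every
      n, so removing the drift changes the bound by a fixed factor.\<close>
    also have "\<dots> = exp (- q * \<mu>) * (exp (q * \<mu> / n) * E q n) ^ n"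
    proof -
      have "exp (- q * \<mu>) * exp (q * \<mu> / n) ^ n = 1"
        using n by (simp add: exp_of_nat_mult[symmetric] exp_minus)
      then show ?thesis by (simp add: power_mult_distrib)
    qed
    also have "\<dots> \<le> exp (- q * \<mu>) * C"
      using bound[OF n] unfolding split E_def by (intro mult_left_mono) auto
    finally show ?thesis by simp
  qed
  then have lim: "(\<lambda>n. n * (E m n - 1)) \<longlonglongrightarrow> m\<^sup>2 * expectation (\<lambda>x. (Z x)\<^sup>2) / 2"
    unfolding E_def by (intro exp_moment_second_order[OF Z Z2 Z0 m int']) auto
  \<comment> \<open>From n (a b - 1) = a n (b - 1) + n (a - 1), with a the drift factor.\<close>
  have "(\<lambda>n. exp (m * \<mu> / n) * (n * (E m n - 1)) + n * (exp (m * \<mu> / n) - 1))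
     \<longlonglongrightarrow> 1 * (m\<^sup>2 * expectation (\<lambda>x. (Z x)\<^sup>2) / 2) + m * \<mu>"
  proof (rule tendsto_add[OF tendsto_mult[OF _ lim] scaled_exp_tendsto])
    show "(\<lambda>n. exp (m * \<mu> / real n)) \<longlonglongrightarrow> 1" by real_asymp
  qed
  then show "(\<lambda>n. real n * (expectation (\<lambda>x. exp (m * (\<mu> / real n + Z x / sqrt (real n)))) - 1))
     \<longlonglongrightarrow> m * \<mu> + m\<^sup>2 * expectation (\<lambda>x. (Z x)\<^sup>2) / 2"
    unfolding split by (simp add: E_def algebra_simps)
  show "integrable M (\<lambda>x. exp (m * (\<mu> / real n + Z x / sqrt (real n))))" if "n \<ge> 1"
    using int[OF that] by (rule integrable_exp_smaller[rotated]) (use m in auto)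
qed

text \<open>Counting powers of 1 / sqrt n: the binomial term with i drift factors has weight
  \<open>2 * i + (j - i)\<close>, and the prefactor n removes weight 2. Weight 1 is the mean of
  \<open>Z\<close>, which is 0; weight 2 means \<open>j = 1\<close>, \<open>i = 1\<close> or
  \<open>j = 2\<close>, \<open>i = 0\<close> and gives the limit; higher weights vanish
  asymptotically.\<close>

lemma (in prob_space) rescaled_moment:
  fixes Z :: "'a \<Rightarrow> real"
  assumes Z[measurable]: "Z \<in> borel_measurable M" and Z0: "expectation Z = 0"
    and int: "\<And>j. j \<le> P \<Longrightarrow> integrable M (\<lambda>x. \<bar>Z x\<bar> ^ j)" and j: "j \<le> P"
  shows rescaled_moment_integrable: "integrable M (\<lambda>x. (\<mu> / real n + Z x / sqrt (real n)) ^ j)"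
    and rescaled_moment_tendsto: "j \<ge> 1 \<Longrightarrow>
      (\<lambda>n. real n * expectation (\<lambda>x. (\<mu> / real n + Z x / sqrt (real n)) ^ j)) \<longlonglongrightarrow>
       (if j = 1 then \<mu> else if j = 2 then expectation (\<lambda>x. (Z x)\<^sup>2) else 0)"
proof -
  have intZ: "integrable M (\<lambda>x. Z x ^ i)" if "i \<le> P" for i
    by (rule Bochner_Integration.integrable_bound[OF int[OF that]]) (auto simp: power_abs)
  have expand: "(\<mu> / real n + Z x / sqrt (real n)) ^ j =
      (\<Sum>i\<le>j. (of_nat (j choose i) * (\<mu> / n) ^ i / sqrt n ^ (j - i)) * Z x ^ (j - i))" for n x
    unfolding binomial_ring by (simp add: power_divide)
  show "integrable M (\<lambda>x. (\<mu> / real n + Z x / sqrt (real n)) ^ j)"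
    unfolding expand using j by (intro Bochner_Integration.integrable_sum integrable_mult_right intZ) auto
  assume j1: "j \<ge> 1"
  have eq: "expectation (\<lambda>x. (\<mu> / real n + Z x / sqrt (real n)) ^ j) =
      (\<Sum>i\<le>j. (of_nat (j choose i) * (\<mu> / n) ^ i / sqrt n ^ (j - i)) * expectation (\<lambda>x. Z x ^ (j - i)))" for n
    unfolding expand using j by (subst Bochner_Integration.integral_sum)
      (auto intro!: Bochner_Integration.integrable_sum integrable_mult_right intZ sum.cong)
  define L where "L i = (if j = 1 \<and> i = 1 then \<mu> else if j = 2 \<and> i = 0 then expectation (\<lambda>x. (Z x)\<^sup>2) else 0)" for i :: nat
  have "(\<lambda>n. \<Sum>i\<le>j. real n * ((of_nat (j choose i) * (\<mu> / n) ^ i / sqrt n ^ (j - i)) * expectation (\<lambda>x. Z x ^ (j - i))))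
     \<longlonglongrightarrow> (\<Sum>i\<le>j. L i)"
  proof (rule tendsto_sum)
    fix i assume i: "i \<in> {..j}"
    define K where "K = of_nat (j choose i) * \<mu> ^ i * expectation (\<lambda>x. Z x ^ (j - i))"
    have K: "real n * ((of_nat (j choose i) * (\<mu> / n) ^ i / sqrt n ^ (j - i)) * expectation (\<lambda>x. Z x ^ (j - i)))
        = K * (real n * (1 / n) ^ i * (1 / sqrt n) ^ (j - i))" for n :: nat
      by (simp add: K_def power_divide)
    have Keq: "K * (real n * (1 / n) ^ i * (1 / sqrt n) ^ (j - i)) = K * (1 / sqrt n) ^ (2 * i + (j - i) - 2)"
      if "n \<ge> 1" "2 * i + (j - i) \<ge> 2" for n :: nat
    proof -
      have "1 / real n = (1 / sqrt n)\<^sup>2" by (simp add: power_divide)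
      then have "real n * (1 / n) ^ i * (1 / sqrt n) ^ (j - i) = real n * (1 / sqrt n) ^ (2 * i + (j - i))"
        by (simp add: power_mult power_add)
      also have "2 * i + (j - i) = 2 + (2 * i + (j - i) - 2)" using that by simp
      also have "real n * (1 / sqrt n) ^ (2 + (2 * i + (j - i) - 2)) = (1 / sqrt n) ^ (2 * i + (j - i) - 2)"
        using that(1) unfolding power_add by (simp add: power_divide)
      finally show ?thesis by simp
    qed
    have sqrt0: "(\<lambda>n. 1 / sqrt (real n)) \<longlonglongrightarrow> 0" by real_asymp
    consider "j = 1" "i = 0" | "2 * i + (j - i) = 2" | "2 * i + (j - i) > 2" using j1 i by force
    then have "(\<lambda>n. K * (real n * (1 / n) ^ i * (1 / sqrt n) ^ (j - i))) \<longlonglongrightarrow> L i"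
    proof cases
      case 1
      then have "K = 0" using Z0 by (simp add: K_def)
      then show ?thesis using 1 by (simp add: L_def)
    next
      case 2
      then have "j = 1 \<and> i = 1 \<or> j = 2 \<and> i = 0" using i by auto
      then have "K = L i" using prob_space by (auto simp: K_def L_def)
      have "\<forall>\<^sub>F n in sequentially. L i = K * (real n * (1 / n) ^ i * (1 / sqrt n) ^ (j - i))"
        using eventually_ge_at_top[of 1] by eventually_elim (use Keq 2 \<open>K = L i\<close> in simp)
      then show ?thesis by (rule Lim_transform_eventually[OF tendsto_const])
    next
      case 3
      then have "L i = 0" by (auto simp: L_def)
      have "(\<lambda>n. K * (1 / sqrt (real n)) ^ (2 * i + (j - i) - 2)) \<longlonglongrightarrow> K * 0 ^ (2 * i + (j - i) - 2)"
        by (intro tendsto_intros sqrt0)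
      then have "(\<lambda>n. K * (1 / sqrt (real n)) ^ (2 * i + (j - i) - 2)) \<longlonglongrightarrow> L i"
        using 3 \<open>L i = 0\<close> by (simp add: power_0_left)
      moreover have "\<forall>\<^sub>F n in sequentially. K * (1 / sqrt (real n)) ^ (2 * i + (j - i) - 2)
          = K * (real n * (1 / n) ^ i * (1 / sqrt n) ^ (j - i))"
        using eventually_ge_at_top[of 1] by eventually_elim (rule Keq[symmetric], use 3 in auto)
      ultimately show ?thesis by (rule Lim_transform_eventually)
    qed
    then show "(\<lambda>n. real n * ((of_nat (j choose i) * (\<mu> / n) ^ i / sqrt n ^ (j - i)) * expectation (\<lambda>x. Z x ^ (j - i)))) \<longlonglongrightarrow> L i"
      unfolding K .
  qed
  moreover have "(\<Sum>i\<le>j. L i) = (if j = 1 then \<mu> else if j = 2 then expectation (\<lambda>x. (Z x)\<^sup>2) else 0)"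
  proof -
    have "(\<Sum>i\<le>j. L i) = (\<Sum>i\<in>{0, 1}. L i)"
      using j1 by (intro sum.mono_neutral_right) (auto simp: L_def)
    then show ?thesis by (simp add: L_def)
  qed
  ultimately show "(\<lambda>n. real n * expectation (\<lambda>x. (\<mu> / real n + Z x / sqrt (real n)) ^ j)) \<longlonglongrightarrow>
       (if j = 1 then \<mu> else if j = 2 then expectation (\<lambda>x. (Z x)\<^sup>2) else 0)"
    unfolding eq sum_distrib_left by simp
qed

section \<open>Convergence of the moments of the recursion\<close>

context prob_space
begin

text \<open>In the one-step matrix the entry \<open>j = 0\<close> is the moment of V alone and
  produces \<open>a_p\<close>. For j > 0 the factor \<open>u n j\<close> is already O(1/n), so of
  \<open>w\<close> only the limit 1 counts, and the binomials p and p (p - 1) / 2 produce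
  \<open>b_p\<close> and \<open>c_p\<close>. Since \<open>d\<close> enters the entries with j > 0
  only through this limit, both schemes share one limit.\<close>

lemma lin_rec_moments_tendsto:
  fixes U V :: "nat \<Rightarrow> nat \<Rightarrow> 'a \<Rightarrow> real"
  assumes indep: "\<And>n. n \<ge> 1 \<Longrightarrow> indep_vars (\<lambda>_. borel) (case_sum (U n) (V n)) (Inl ` {1..n} \<union> Inr ` {1..n})"
    and d: "d \<in> borel_measurable borel"
    and U: "\<And>n k j. k \<in> {1..n} \<Longrightarrow> j \<le> P \<Longrightarrow> has_bochner_integral M (\<lambda>x. U n k x ^ j) (u n j)"
    and V: "\<And>n k i j. k \<in> {1..n} \<Longrightarrow> j + i \<le> P \<Longrightarrow>
        has_bochner_integral M (\<lambda>x. d (V n k x) ^ j * V n k x ^ i) (w n j i)"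
    and u_lim: "\<And>j. 1 \<le> j \<Longrightarrow> j \<le> P \<Longrightarrow>
        (\<lambda>n. real n * u n j) \<longlonglongrightarrow> (if j = 1 then \<mu>\<xi> else if j = 2 then \<sigma>\<xi>\<^sup>2 else 0)"
    and w0_lim: "\<And>i. i \<le> P \<Longrightarrow> (\<lambda>n. real n * (w n 0 i - 1)) \<longlonglongrightarrow> real i * \<mu>\<rho> + (real i)\<^sup>2 * \<sigma>\<rho>\<^sup>2 / 2"
    and w_lim: "\<And>i j. j + i \<le> P \<Longrightarrow> (\<lambda>n. w n j i) \<longlonglongrightarrow> 1"
    and p: "p \<le> P"
  shows "(\<lambda>n. expectation (\<lambda>x. lin_rec d (U n) (V n) y n x ^ p)) \<longlonglongrightarrow> mom y \<mu>\<xi> \<sigma>\<xi> \<mu>\<rho> \<sigma>\<rho> p 1"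
proof (rule euler_scheme_tendsto[where P = P and m = "mom y \<mu>\<xi> \<sigma>\<xi> \<mu>\<rho> \<sigma>\<rho>"
      and v = "\<lambda>n k p. expectation (\<lambda>x. lin_rec d (U n) (V n) y k x ^ p)"
      and c = "\<lambda>n p j. of_nat (p choose j) * u n j * w n j (p - j)"
      and A = "moment_generator \<mu>\<xi> \<sigma>\<xi> \<mu>\<rho> \<sigma>\<rho>"])
  show "expectation (\<lambda>x. lin_rec d (U n) (V n) y 0 x ^ p) = mom y \<mu>\<xi> \<sigma>\<xi> \<mu>\<rho> \<sigma>\<rho> p 0" for n p
    by (simp add: mom_0 prob_space)
  show "expectation (\<lambda>x. lin_rec d (U n) (V n) y (Suc k) x ^ p) =
    (\<Sum>j\<le>p. real (p choose j) * u n j * w n j (p - j) * expectation (\<lambda>x. lin_rec d (U n) (V n) y k x ^ (p - j)))"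
    if "n \<ge> 1" "k < n" "p \<le> P" for n k p
    using that by (intro lin_rec_moment_Suc[OF indep d U V]) auto
  show "(\<lambda>n. real n * (of_nat (p choose j) * u n j * w n j (p - j) - (if j = 0 then 1 else 0)))
      \<longlonglongrightarrow> moment_generator \<mu>\<xi> \<sigma>\<xi> \<mu>\<rho> \<sigma>\<rho> p j" if p: "p \<le> P" and j: "j \<le> p" for p j
  proof (cases "j = 0")
    case True
    have u0: "u n 0 = 1" if "n \<ge> 1" for n
      using U[of 1 n 0] that by (simp add: has_bochner_integral_iff prob_space)
    have "\<forall>\<^sub>F n in sequentially. real n * (w n 0 p - 1) =
       real n * (of_nat (p choose j) * u n j * w n j (p - j) - (if j = 0 then 1 else 0))"
      using eventually_ge_at_top[of 1] by eventually_elim (simp add: True u0)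
    with w0_lim[OF p] show ?thesis
      unfolding moment_generator_def using True by (simp add: Lim_transform_eventually)
  next
    case False
    have "(\<lambda>n. of_nat (p choose j) * (real n * u n j) * w n j (p - j)) \<longlonglongrightarrow>
       of_nat (p choose j) * (if j = 1 then \<mu>\<xi> else if j = 2 then \<sigma>\<xi>\<^sup>2 else 0) * 1"
      using False p j by (intro tendsto_mult tendsto_const u_lim w_lim) auto
    moreover have "real (p choose 2) = real p * (real p - 1) / 2"
      by (induction p) (auto simp: numeral_2_eq_2 field_simps)
    then have "of_nat (p choose j) * (if j = 1 then \<mu>\<xi> else if j = 2 then \<sigma>\<xi>\<^sup>2 else 0) * 1 =
        moment_generator \<mu>\<xi> \<sigma>\<xi> \<mu>\<rho> \<sigma>\<rho> p j"
      using False by (simp add: moment_generator_def)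
    ultimately show ?thesis using False by (simp add: mult_ac)
  qed
  show "(mom y \<mu>\<xi> \<sigma>\<xi> \<mu>\<rho> \<sigma>\<rho> p has_real_derivative
     (\<Sum>j\<le>p. moment_generator \<mu>\<xi> \<sigma>\<xi> \<mu>\<rho> \<sigma>\<rho> p j * mom y \<mu>\<xi> \<sigma>\<xi> \<mu>\<rho> \<sigma>\<rho> (p - j) t)) (at t within {0..1})"
    if "t \<in> {0..1}" for p t
    using that by (rule mom_has_derivative)
qed (rule p)

text \<open>Completing the square: the exponential weight shifts the mean of the density to
  \<open>s * \<sigma>^2\<close>.\<close>

lemma normal_exp_moment:
  assumes X: "distributed M lborel X (normal_density 0 \<sigma>)" and \<sigma>: "\<sigma> > 0"
  shows "has_bochner_integral M (\<lambda>x. exp (s * X x)) (exp (s\<^sup>2 * \<sigma>\<^sup>2 / 2))"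
proof -
  have eq: "normal_density 0 \<sigma> x * exp (s * x) = exp (s\<^sup>2 * \<sigma>\<^sup>2 / 2) * normal_density (s * \<sigma>\<^sup>2) \<sigma> x" for x
  proof -
    have "- (x - 0)\<^sup>2 / (2 * \<sigma>\<^sup>2) + s * x = s\<^sup>2 * \<sigma>\<^sup>2 / 2 + - (x - s * \<sigma>\<^sup>2)\<^sup>2 / (2 * \<sigma>\<^sup>2)"
      using \<sigma> by (simp add: power2_eq_square field_simps)
    then show ?thesis
      unfolding normal_density_def by (simp add: exp_add[symmetric])
  qed
  have "integrable lborel (\<lambda>x. normal_density 0 \<sigma> x * exp (s * x))"
    unfolding eq using \<sigma> by simp
  moreover have "integral\<^sup>L lborel (\<lambda>x. normal_density 0 \<sigma> x * exp (s * x)) = exp (s\<^sup>2 * \<sigma>\<^sup>2 / 2)"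
    unfolding eq using \<sigma> by simp
  ultimately show ?thesis
    using distributed_integrable[OF X, of "\<lambda>x. exp (s * x)"] distributed_integral[OF X, of "\<lambda>x. exp (s * x)"]
    by (simp add: has_bochner_integral_iff)
qed

end

text \<open>A Brownian increment over time 1/n is a standard normal variable divided by sqrt n. Its
  moments therefore have the rescaled form of those of \<open>xi_n\<close>, and
  \<open>rescaled_moment\<close> applies on the real line with the standard normal law.\<close>

lemma std_normal_rescaled_moment:
  fixes \<mu> \<sigma> :: real
  defines "u \<equiv> \<lambda>n j. integral\<^sup>L (density lborel std_normal_density) (\<lambda>z. (\<mu> / real n + \<sigma> * z / sqrt (real n)) ^ j)"
  shows std_normal_rescaled_moment_tendsto: "1 \<le> j \<Longrightarrow>
        (\<lambda>n. real n * u n j) \<longlonglongrightarrow> (if j = 1 then \<mu> else if j = 2 then \<sigma>\<^sup>2 else 0)"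
    and normal_moment_eq_std_normal: "prob_space M \<Longrightarrow> n \<ge> 1 \<Longrightarrow>
        distributed M lborel X (normal_density 0 (sqrt (1 / real n))) \<Longrightarrow>
        has_bochner_integral M (\<lambda>x. (\<mu> / real n + \<sigma> * X x) ^ j) (u n j)"
proof -
  let ?G = "density lborel std_normal_density"
  interpret G: prob_space ?G by (rule prob_space_normal_density) simp
  have abs_int: "integrable ?G (\<lambda>z. \<bar>\<sigma> * z\<bar> ^ j)" for j
    using integrable_mult_right[OF integrable_std_normal_moment_abs, of "\<bar>\<sigma>\<bar> ^ j" j]
    by (subst integrable_density) (auto simp: abs_mult power_mult_distrib mult_ac)
  have mean: "integral\<^sup>L ?G (\<lambda>z. \<sigma> * z) = 0"
    using integral_std_normal_moment_odd[of 0]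
    by (subst integral_mult_right_zero, subst integral_density) auto
  have var: "integral\<^sup>L ?G (\<lambda>z. (\<sigma> * z)\<^sup>2) = \<sigma>\<^sup>2"
  proof -
    have "integral\<^sup>L ?G (\<lambda>z. (\<sigma> * z)\<^sup>2) = integral\<^sup>L lborel (\<lambda>z. \<sigma>\<^sup>2 * (std_normal_density z * z ^ (2 * 1)))"
      by (subst integral_density) (auto simp: power_mult_distrib mult_ac)
    also have "\<dots> = \<sigma>\<^sup>2"
      by (subst integral_mult_right_zero, subst integral_std_normal_moment_even) simp
    finally show ?thesis .
  qed
  show "(\<lambda>n. real n * u n j) \<longlonglongrightarrow> (if j = 1 then \<mu> else if j = 2 then \<sigma>\<^sup>2 else 0)" if "1 \<le> j"
    using G.rescaled_moment_tendsto[of "\<lambda>z. \<sigma> * z" j j \<mu>] that abs_int mean unfolding u_def var by simp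
  assume M: "prob_space M" and n: "n \<ge> 1" and X: "distributed M lborel X (normal_density 0 (sqrt (1 / real n)))"
  interpret prob_space M by fact
  have Y: "distributed M lborel (\<lambda>x. 0 + sqrt n * X x) (normal_density (0 + sqrt n * 0) (\<bar>sqrt n\<bar> * sqrt (1 / real n)))"
    using n by (intro normal_density_affine[OF X]) auto
  have "\<bar>sqrt n\<bar> * sqrt (1 / real n) = 1" using n by (simp add: real_sqrt_divide)
  with Y have Y: "distributed M lborel (\<lambda>x. sqrt n * X x) std_normal_density" by simp
  let ?g = "\<lambda>z. (\<mu> / real n + \<sigma> * z / sqrt (real n)) ^ j"
  have "integrable ?G ?g"
    using G.rescaled_moment_integrable[of "\<lambda>z. \<sigma> * z" j j \<mu>] abs_int mean by simp
  then have "integrable lborel (\<lambda>z. std_normal_density z * ?g z)"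
    by (subst (asm) integrable_density) auto
  moreover have "integral\<^sup>L lborel (\<lambda>z. std_normal_density z * ?g z) = u n j"
    unfolding u_def by (subst integral_density) auto
  ultimately have "has_bochner_integral M (\<lambda>x. ?g (sqrt n * X x)) (u n j)"
    using distributed_integrable[OF Y, of ?g] distributed_integral[OF Y, of ?g]
    by (simp add: has_bochner_integral_iff)
  then show "has_bochner_integral M (\<lambda>x. (\<mu> / real n + \<sigma> * X x) ^ j) (u n j)"
    using n by simp
qed

subsection \<open>Independence and convergence tools\<close>

context prob_space
begin

lemma indep_vars_reindex:
  assumes f: "inj_on f I" and X: "indep_vars M' X (f ` I)"
  shows "indep_vars (\<lambda>i. M' (f i)) (\<lambda>i. X (f i)) I"
  unfolding indep_vars_def2
proof (intro conjI ballI)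
  show "X (f i) \<in> measurable M (M' (f i))" if "i \<in> I" for i
    using X that by (auto simp: indep_vars_def2)
  let ?F = "\<lambda>i. {X i -` A \<inter> space M |A. A \<in> sets (M' i)}"
  have ind: "indep_sets ?F (f ` I)" using X by (simp add: indep_vars_def2)
  show "indep_sets (\<lambda>i. ?F (f i)) I"
  proof (rule indep_setsI)
    show "?F (f i) \<subseteq> events" if "i \<in> I" for i
      using ind that unfolding indep_sets_def by blast
  next
    fix A J assume J: "J \<noteq> {}" "J \<subseteq> I" "finite J" and A: "\<forall>j\<in>J. A j \<in> ?F (f j)"
    have inj: "inj_on f J" using f J by (auto intro: inj_on_subset)
    have inv: "inv_into J f (f j) = j" if "j \<in> J" for j using inj that by simp
    have "prob (\<Inter>j\<in>f ` J. A (inv_into J f j)) = (\<Prod>j\<in>f ` J. prob (A (inv_into J f j)))"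
    proof (rule indep_setsD[OF ind])
      show "\<forall>j\<in>f ` J. A (inv_into J f j) \<in> ?F j" using A inv by auto
    qed (use J in auto)
    then show "prob (\<Inter>j\<in>J. A j) = (\<Prod>j\<in>J. prob (A j))"
      by (simp add: prod.reindex[OF inj] inv cong: INF_cong_simp prod.cong_simp)
  qed
qed

text \<open>A finite intersection of events splits into a part in \<open>S\<close> and a part in
  \<open>T\<close>. Independence of the two sigma-algebras separates the parts, and independence
  within each family factors them further.\<close>

lemma indep_vars_case_sum:
  fixes U :: "'i \<Rightarrow> 'a \<Rightarrow> real" and V :: "'j \<Rightarrow> 'a \<Rightarrow> real"
  assumes U: "indep_vars (\<lambda>_. borel) U I" and V: "indep_vars (\<lambda>_. borel) V J"
    and space: "space S = space M" "space T = space M" and indep: "indep_set (sets S) (sets T)"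
    and US: "\<And>i. i \<in> I \<Longrightarrow> U i \<in> borel_measurable S"
    and VT: "\<And>j. j \<in> J \<Longrightarrow> V j \<in> borel_measurable T"
  shows "indep_vars (\<lambda>_. borel) (case_sum U V) (Inl ` I \<union> Inr ` J)"
  unfolding indep_vars_def2
proof (intro conjI ballI)
  let ?X = "case_sum U V"
  show rv: "random_variable borel (?X k)" if "k \<in> Inl ` I \<union> Inr ` J" for k
    using U V that by (auto simp: indep_vars_def2)
  show "indep_sets (\<lambda>k. {?X k -` A \<inter> space M |A. A \<in> sets borel}) (Inl ` I \<union> Inr ` J)"
  proof (rule indep_setsI)
    show "{?X k -` A \<inter> space M |A. A \<in> sets borel} \<subseteq> events" if "k \<in> Inl ` I \<union> Inr ` J" for k
      using rv[OF that] by (auto intro: measurable_sets)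
  next
    fix A K assume K: "K \<noteq> {}" "K \<subseteq> Inl ` I \<union> Inr ` J" "finite K"
      and A: "\<forall>k\<in>K. A k \<in> {?X k -` A \<inter> space M |A. A \<in> sets borel}"
    then have "\<forall>k\<in>K. \<exists>B. B \<in> sets borel \<and> A k = ?X k -` B \<inter> space M" by blast
    from bchoice[OF this] obtain B where
      B: "\<And>k. k \<in> K \<Longrightarrow> B k \<in> sets borel" "\<And>k. k \<in> K \<Longrightarrow> A k = ?X k -` B k \<inter> space M"
      by blast
    define KU KV where "KU = Inl -` K" and "KV = Inr -` K"
    have KU: "finite KU" "KU \<subseteq> I" and KV: "finite KV" "KV \<subseteq> J"
      using K by (auto simp: KU_def KV_def intro!: finite_vimageI)
    have Keq: "K = Inl ` KU \<union> Inr ` KV"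
      by (auto simp: KU_def KV_def image_iff) (metis sumE)
    \<comment> \<open>The intersection with \<open>space M\<close> makes the formula cover
      \<open>L = {}\<close>, where the bare intersection would be \<open>UNIV\<close>. This happens
      when \<open>K\<close> meets only one of the two families.\<close>
    have part: "prob (space M \<inter> (\<Inter>i\<in>L. Y i -` C i \<inter> space M)) = (\<Prod>i\<in>L. prob (Y i -` C i \<inter> space M))"
      if "indep_vars (\<lambda>_. borel) Y L'" "finite L" "L \<subseteq> L'" "\<And>i. i \<in> L \<Longrightarrow> C i \<in> sets borel"
      for Y :: "'z \<Rightarrow> 'a \<Rightarrow> real" and L L' and C :: "'z \<Rightarrow> real set"
    proof (cases "L = {}")
      case False
      then have "space M \<inter> (\<Inter>i\<in>L. Y i -` C i \<inter> space M) = (\<Inter>i\<in>L. Y i -` C i \<inter> space M)" by auto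
      then show ?thesis using indep_varsD[OF that(1) False that(2,3,4)] by simp
    qed (simp add: prob_space)
    have meas: "space M \<inter> (\<Inter>i\<in>L. Y i -` C i \<inter> space M) \<in> sets R"
      if "space R = space M" "finite L" "\<And>i. i \<in> L \<Longrightarrow> Y i \<in> borel_measurable R" "\<And>i. i \<in> L \<Longrightarrow> C i \<in> sets borel"
      for Y :: "'z \<Rightarrow> 'a \<Rightarrow> real" and L and C :: "'z \<Rightarrow> real set" and R
    proof (cases "L = {}")
      case True
      then show ?thesis using sets.top[of R] that(1) by simp
    next
      case False
      have "(\<Inter>i\<in>L. Y i -` C i \<inter> space M) \<in> sets R"
        using that False by (intro sets.finite_INT) (auto simp flip: that(1))
      then show ?thesis using sets.top[of R] that(1) by (metis sets.Int)
    qed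
    have "(\<Inter>k\<in>K. A k) = (space M \<inter> (\<Inter>i\<in>KU. U i -` B (Inl i) \<inter> space M)) \<inter>
        (space M \<inter> (\<Inter>j\<in>KV. V j -` B (Inr j) \<inter> space M))" (is "_ = ?E \<inter> ?F")
    proof -
      have "(\<Inter>k\<in>K. A k) = space M \<inter> (\<Inter>k\<in>K. ?X k -` B k \<inter> space M)"
        using K(1) B(2) by auto
      also have "(\<Inter>k\<in>K. ?X k -` B k \<inter> space M) =
          (\<Inter>i\<in>KU. U i -` B (Inl i) \<inter> space M) \<inter> (\<Inter>j\<in>KV. V j -` B (Inr j) \<inter> space M)"
        by (subst Keq) (simp only: INT_Un INT_simps(10) sum.case)
      finally show ?thesis by blast
    qed
    then have "prob (\<Inter>k\<in>K. A k) = prob (?E \<inter> ?F)" by simp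
    also have "\<dots> = prob ?E * prob ?F"
    proof -
      have "?E \<in> sets S"
        by (rule meas[OF space(1) KU(1)]) (use KU(2) B(1) US in \<open>auto simp: KU_def\<close>)
      moreover have "?F \<in> sets T"
        by (rule meas[OF space(2) KV(1)]) (use KV(2) B(1) VT in \<open>auto simp: KV_def\<close>)
      ultimately show ?thesis using indep unfolding indep_sets2_eq by blast
    qed
    also have "prob ?E = (\<Prod>k\<in>Inl ` KU. prob (A k))"
    proof -
      have "prob ?E = (\<Prod>i\<in>KU. prob (U i -` B (Inl i) \<inter> space M))"
        by (rule part[OF U KU]) (use B(1) in \<open>auto simp: KU_def\<close>)
      also have "\<dots> = (\<Prod>i\<in>KU. prob (A (Inl i)))"
        by (intro prod.cong) (auto simp: B(2) KU_def)
      finally show ?thesis by (simp only: prod.reindex[OF inj_Inl] comp_def)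
    qed
    also have "prob ?F = (\<Prod>k\<in>Inr ` KV. prob (A k))"
    proof -
      have "prob ?F = (\<Prod>i\<in>KV. prob (V i -` B (Inr i) \<inter> space M))"
        by (rule part[OF V KV]) (use B(1) in \<open>auto simp: KV_def\<close>)
      also have "\<dots> = (\<Prod>i\<in>KV. prob (A (Inr i)))"
        by (intro prod.cong) (auto simp: B(2) KV_def)
      finally show ?thesis by (simp only: prod.reindex[OF inj_Inr] comp_def)
    qed
    also have "(\<Prod>k\<in>Inl ` KU. prob (A k)) * (\<Prod>k\<in>Inr ` KV. prob (A k)) = (\<Prod>k\<in>K. prob (A k))"
      using KU KV by (subst Keq, intro prod.union_disjoint[symmetric]) auto
    finally show "prob (\<Inter>k\<in>K. A k) = (\<Prod>k\<in>K. prob (A k))" .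
  qed
qed

section \<open>From convergence in probability to convergence of expectations\<close>

text \<open>Borel-Cantelli with deviations above 2^(-k) of probability below 2^(-k). The indices
  \<open>r k\<close> merely tend to infinity, which suffices for composing limits.\<close>

lemma tendsto_in_prob_AE_subseq:
  fixes S :: "nat \<Rightarrow> 'a \<Rightarrow> real"
  assumes [measurable]: "\<And>m. S m \<in> borel_measurable M" "X \<in> borel_measurable M"
    and lim: "tendsto_in_prob M S X"
  obtains r where "filterlim r at_top sequentially" "AE x in M. (\<lambda>k. S (r k) x) \<longlonglongrightarrow> X x"
proof -
  have "\<exists>m\<ge>k. measure M {x\<in>space M. \<bar>S m x - X x\<bar> > (1 / 2) ^ k} < (1 / 2) ^ k" for k
  proof -
    have "(\<lambda>m. measure M {x\<in>space M. \<bar>S m x - X x\<bar> > (1 / 2) ^ k}) \<longlonglongrightarrow> 0"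
      using lim unfolding tendsto_in_prob_def by simp
    then have "\<forall>\<^sub>F m in sequentially. measure M {x\<in>space M. \<bar>S m x - X x\<bar> > (1 / 2) ^ k} < (1 / 2) ^ k"
      by (rule order_tendstoD) simp
    then have "\<forall>\<^sub>F m in sequentially. measure M {x\<in>space M. \<bar>S m x - X x\<bar> > (1 / 2) ^ k} < (1 / 2) ^ k \<and> k \<le> m"
      using eventually_ge_at_top[of k] by (rule eventually_conj)
    then show ?thesis using eventually_happens'[OF sequentially_bot] by blast
  qed
  then obtain r where r: "\<And>k. k \<le> r k"
    "\<And>k. measure M {x\<in>space M. \<bar>S (r k) x - X x\<bar> > (1 / 2) ^ k} < (1 / 2) ^ k" by metis
  show ?thesis
  proof (rule that[of r])
    show "filterlim r at_top sequentially"
      using r(1) by (intro filterlim_at_top_mono[OF filterlim_ident]) auto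
    let ?A = "\<lambda>k. {x\<in>space M. \<bar>S (r k) x - X x\<bar> > (1 / 2) ^ k}"
    have "summable (\<lambda>k. measure M (?A k))"
      by (rule summable_comparison_test[OF _ summable_geometric[of "1 / 2 :: real"]])
        (use r(2) in \<open>auto intro!: exI[of _ 0] less_imp_le\<close>)
    then have "AE x in M. eventually (\<lambda>k. x \<in> space M - ?A k) sequentially"
      by (intro borel_cantelli_AE1) (auto simp: emeasure_eq_measure)
    then show "AE x in M. (\<lambda>k. S (r k) x) \<longlonglongrightarrow> X x"
    proof eventually_elim
      case (elim x)
      have "(\<lambda>k. S (r k) x - X x) \<longlonglongrightarrow> 0"
      proof (rule Lim_null_comparison)
        show "\<forall>\<^sub>F k in sequentially. norm (S (r k) x - X x) \<le> (1 / 2) ^ k"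
          using elim by eventually_elim auto
        show "(\<lambda>k. (1 / 2 :: real) ^ k) \<longlonglongrightarrow> 0" by (rule LIMSEQ_power_zero) simp
      qed
      then show ?case by (simp add: LIM_zero_iff)
    qed
  qed
qed

text \<open>Clipping at level \<open>K\<close> changes z by at most z^2 / K, hence changes
  expectations by at most C / K uniformly in n; Fatou's lemma extends the second-moment bound, and
  so this estimate, to the limit. The clipped variables converge by bounded convergence.\<close>

lemma expectation_tendsto_L2_bounded:
  fixes X :: "nat \<Rightarrow> 'a \<Rightarrow> real"
  assumes [measurable]: "\<And>n. X n \<in> borel_measurable M" "Y \<in> borel_measurable M"
    and lim: "AE x in M. (\<lambda>n. X n x) \<longlonglongrightarrow> Y x"
    and int: "\<And>n. integrable M (\<lambda>x. (X n x)\<^sup>2)" and bound: "\<And>n. expectation (\<lambda>x. (X n x)\<^sup>2) \<le> C"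
  shows "(\<lambda>n. expectation (X n)) \<longlonglongrightarrow> expectation Y"
proof (rule tendstoI)
  fix \<epsilon> :: real assume \<epsilon>: "\<epsilon> > 0"
  have C0: "C \<ge> 0"
  proof -
    have "0 \<le> expectation (\<lambda>x. (X 0 x)\<^sup>2)" by simp
    also have "\<dots> \<le> C" by (rule bound)
    finally show ?thesis .
  qed
  have "(\<integral>\<^sup>+ x. ennreal ((Y x)\<^sup>2) \<partial>M) = (\<integral>\<^sup>+ x. liminf (\<lambda>n. ennreal ((X n x)\<^sup>2)) \<partial>M)"
  proof (rule nn_integral_cong_AE)
    show "AE x in M. ennreal ((Y x)\<^sup>2) = liminf (\<lambda>n. ennreal ((X n x)\<^sup>2))"
      using lim
    proof eventually_elim
      case (elim x)
      then have "(\<lambda>n. ennreal ((X n x)\<^sup>2)) \<longlonglongrightarrow> ennreal ((Y x)\<^sup>2)"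
        by (intro tendsto_ennrealI tendsto_power)
      then show ?case by (intro lim_imp_Liminf[symmetric]) auto
    qed
  qed
  also have "\<dots> \<le> liminf (\<lambda>n. \<integral>\<^sup>+ x. ennreal ((X n x)\<^sup>2) \<partial>M)" by (intro nn_integral_liminf) measurable
  also have "\<dots> \<le> liminf (\<lambda>n. ennreal C)"
    using int bound by (intro Liminf_mono always_eventually allI) (simp add: nn_integral_eq_integral ennreal_leI)
  also have "\<dots> = ennreal C" by (simp add: Liminf_const)
  finally have Yn: "(\<integral>\<^sup>+ x. ennreal ((Y x)\<^sup>2) \<partial>M) \<le> ennreal C" .
  have Yint: "integrable M (\<lambda>x. (Y x)\<^sup>2)"
    using Yn by (intro integrableI_bounded) (auto simp: top_unique less_top[symmetric])
  have Ybound: "expectation (\<lambda>x. (Y x)\<^sup>2) \<le> C"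
    using Yn Yint C0 by (simp add: nn_integral_eq_integral)
  \<comment> \<open>The summand 1 keeps \<open>K\<close> positive when \<open>C = 0\<close>, and the
    factor 4 puts C / K below \<open>\<epsilon> / 3\<close>.\<close>
  define K where "K = 4 * (C + 1) / \<epsilon>"
  have K: "K > 0" "C / K < \<epsilon> / 3"
    using \<epsilon> C0 by (auto simp: K_def field_simps intro: add_nonneg_pos)
  define clip where "clip z = max (- K) (min K z)" for z :: real
  have clip_le: "\<bar>clip z\<bar> \<le> K" for z using K(1) by (auto simp: clip_def)
  have clip_err: "\<bar>z - clip z\<bar> \<le> z\<^sup>2 / K" for z
  proof (cases "\<bar>z\<bar> \<le> K")
    case True
    then have "clip z = z" by (auto simp: clip_def)
    then show ?thesis using K(1) by simp
  next
    case False
    have "\<bar>z - clip z\<bar> \<le> \<bar>z\<bar>" using False K(1) by (auto simp: clip_def)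
    also have "\<dots> \<le> z\<^sup>2 / K"
      using False K(1) mult_left_mono[of K "\<bar>z\<bar>" "\<bar>z\<bar>"] by (simp add: field_simps power2_eq_square flip: abs_mult)
    finally show ?thesis .
  qed
  have [measurable]: "clip \<in> borel_measurable borel" unfolding clip_def by measurable
  have err: "\<bar>expectation Z - expectation (\<lambda>x. clip (Z x))\<bar> \<le> C / K"
    if [measurable]: "Z \<in> borel_measurable M" and Z: "integrable M (\<lambda>x. (Z x)\<^sup>2)" "expectation (\<lambda>x. (Z x)\<^sup>2) \<le> C" for Z
  proof -
    have Z1: "integrable M Z" using square_integrable_imp_integrable[OF _ Z(1)] by simp
    have cl: "integrable M (\<lambda>x. clip (Z x))"
      by (rule integrable_const_bound[where B = K]) (use clip_le in auto)
    have "\<bar>expectation Z - expectation (\<lambda>x. clip (Z x))\<bar> = \<bar>expectation (\<lambda>x. Z x - clip (Z x))\<bar>"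
      using Z1 cl by simp
    also have "\<dots> \<le> expectation (\<lambda>x. \<bar>Z x - clip (Z x)\<bar>)" by (rule integral_abs_bound)
    also have "\<dots> \<le> expectation (\<lambda>x. (Z x)\<^sup>2 / K)"
      using Z1 cl Z clip_err by (intro integral_mono) auto
    also have "\<dots> \<le> C / K" using Z(2) K(1) by (simp add: divide_right_mono)
    finally show ?thesis .
  qed
  have "(\<lambda>n. expectation (\<lambda>x. clip (X n x))) \<longlonglongrightarrow> expectation (\<lambda>x. clip (Y x))"
  proof (rule integral_dominated_convergence[where w = "\<lambda>_. K"])
    show "AE x in M. (\<lambda>n. clip (X n x)) \<longlonglongrightarrow> clip (Y x)"
      using lim by eventually_elim (auto simp: clip_def intro!: tendsto_intros)
  qed (use clip_le in auto)
  from tendstoD[OF this, of "\<epsilon> / 3"] \<epsilon>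
  have "\<forall>\<^sub>F n in sequentially. dist (expectation (\<lambda>x. clip (X n x))) (expectation (\<lambda>x. clip (Y x))) < \<epsilon> / 3"
    by simp
  then show "\<forall>\<^sub>F n in sequentially. dist (expectation (X n)) (expectation Y) < \<epsilon>"
  proof eventually_elim
    case (elim n)
    have 1: "\<bar>expectation (X n) - expectation (\<lambda>x. clip (X n x))\<bar> \<le> C / K"
      using int bound by (intro err) auto
    have 2: "\<bar>expectation Y - expectation (\<lambda>x. clip (Y x))\<bar> \<le> C / K"
      using Yint Ybound by (intro err) auto
    show ?case using elim 1 2 K(2) unfolding dist_real_def by linarith
  qed
qed

end

subsection \<open>The moments of the limit process\<close>

lemma brownian_motionD:
  assumes "brownian_motion N W"
  shows brownian_motion_prob_space: "prob_space N"
    and brownian_motion_measurable: "t \<ge> 0 \<Longrightarrow> W t \<in> borel_measurable N"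
    and brownian_motion_0: "\<omega> \<in> space N \<Longrightarrow> W 0 \<omega> = 0"
  using assms by (auto simp: brownian_motion_def)

lemma brownian_motion_grid_distributed:
  assumes "brownian_motion N W" and k: "k \<in> {1..n}"
  shows "distributed N lborel (\<lambda>\<omega>. W (real k / real n) \<omega> - W ((real k - 1) / real n) \<omega>)
    (normal_density 0 (sqrt (1 / real n)))"
proof -
  have "0 \<le> (real k - 1) / real n" "(real k - 1) / real n < real k / real n"
    using k by (auto simp: divide_strict_right_mono)
  then have "distributed N lborel (\<lambda>\<omega>. W (real k / real n) \<omega> - W ((real k - 1) / real n) \<omega>)
      (normal_density 0 (sqrt (real k / real n - (real k - 1) / real n)))"
    using assms(1) unfolding brownian_motion_def by blast
  moreover have "real k / real n - (real k - 1) / real n = 1 / real n"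
    by (simp add: diff_divide_distrib)
  ultimately show ?thesis by simp
qed

lemma brownian_motion_grid_indep:
  assumes BM: "brownian_motion N W" and n: "n \<ge> 1"
  shows "prob_space.indep_vars N (\<lambda>_. borel)
    (\<lambda>k \<omega>. W (real k / real n) \<omega> - W ((real k - 1) / real n) \<omega>) {1..n}"
proof -
  interpret prob_space N using BM by (rule brownian_motion_prob_space)
  have mono: "\<forall>i<n. real i / real n < real (Suc i) / real n" using n by (simp add: divide_strict_right_mono)
  have grid: "\<forall>(ts :: nat \<Rightarrow> real) k. 0 \<le> ts 0 \<and> (\<forall>i<k. ts i < ts (Suc i)) \<longrightarrow>
        indep_vars (\<lambda>_. borel) (\<lambda>i \<omega>. W (ts (Suc i)) \<omega> - W (ts i) \<omega>) {..<k}"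
    using BM by (simp add: brownian_motion_def)
  have ind: "indep_vars (\<lambda>_. borel)
      (\<lambda>i \<omega>. W (real (Suc i) / real n) \<omega> - W (real i / real n) \<omega>) {..<n}"
    using grid[THEN spec, of "\<lambda>i. real i / real n", THEN spec, of n] mono by simp
  \<comment> \<open>Brownian increments are indexed from 0, the coefficients of the recursion from
    1.\<close>
  have "(\<lambda>k. k - 1) ` {1..n} = {..<n}"
    by (auto simp: image_iff intro!: bexI[of _ "Suc _"])
  with ind have "indep_vars (\<lambda>_. borel)
      (\<lambda>k \<omega>. W (real (Suc (k - 1)) / real n) \<omega> - W (real (k - 1) / real n) \<omega>) {1..n}"
    by (intro indep_vars_reindex[where f = "\<lambda>k. k - 1" and M' = "\<lambda>_. borel"]) (auto simp: inj_on_def)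
  then show ?thesis
    by (rule iffD1[OF indep_vars_cong, rotated 3]) (auto simp: of_nat_diff)
qed

lemma sets_process_sigma: "sets (sigma (space N) (process_sigma N W)) = process_sigma N W"
proof -
  have "sigma_algebra (space N) (process_sigma N W)"
    unfolding process_sigma_def by (rule sigma_algebra_sigma_sets) auto
  then show ?thesis by (rule sigma_algebra.sets_measure_of_eq)
qed

lemma process_measurable_process_sigma:
  assumes t: "t \<ge> 0"
  shows "W t \<in> borel_measurable (sigma (space N) (process_sigma N W))"
proof (rule measurableI)
  fix B :: "real set" assume "B \<in> sets borel"
  then have "W t -` B \<inter> space N \<in> process_sigma N W"
    unfolding process_sigma_def using t by (intro sigma_sets.Basic) auto
  then show "W t -` B \<inter> space (sigma (space N) (process_sigma N W))
      \<in> sets (sigma (space N) (process_sigma N W))"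
    by (simp add: sets_process_sigma space_measure_of_conv)
qed simp

text \<open>\<open>W'\<close> drives the additive coefficients, which form the left summand, and
  \<open>W\<close> the multiplicative ones; this is why the two sigma-algebras are swapped.\<close>

lemma indep_brownian_motions_grid_indep:
  assumes BM: "indep_brownian_motions N W W'" and n: "n \<ge> 1"
  shows "prob_space.indep_vars N (\<lambda>_. borel)
    (case_sum (\<lambda>k \<omega>. W' (real k / real n) \<omega> - W' ((real k - 1) / real n) \<omega>)
      (\<lambda>k \<omega>. W (real k / real n) \<omega> - W ((real k - 1) / real n) \<omega>)) (Inl ` {1..n} \<union> Inr ` {1..n})"
proof -
  have W: "brownian_motion N W" and W': "brownian_motion N W'"
    and ind: "prob_space.indep_set N (process_sigma N W) (process_sigma N W')"
    using BM by (auto simp: indep_brownian_motions_def)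
  interpret prob_space N using W by (rule brownian_motion_prob_space)
  have "indep_set (process_sigma N W') (process_sigma N W)"
    using ind unfolding indep_sets2_eq by (metis Int_commute mult.commute)
  then show ?thesis
    using n brownian_motion_grid_indep[OF W n] brownian_motion_grid_indep[OF W' n]
    by (intro indep_vars_case_sum[where S = "sigma (space N) (process_sigma N W')"
        and T = "sigma (space N) (process_sigma N W)"])
      (auto simp: sets_process_sigma space_measure_of_conv intro!: borel_measurable_diff process_measurable_process_sigma)
qed

text \<open>The Riemann sum weights an increment with \<open>exp (- R)\<close> at the left end of
  its cell, while the prefactor is \<open>exp (R)\<close> at the right end. Their product is the new
  multiplicative coefficient, so the increment of X is multiplied by it as well: this is the origin
  of d(v) = v.\<close>

lemma lin_rec_eq_stochastic_exponential:
  fixes X R :: "real \<Rightarrow> 'b \<Rightarrow> real"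
  assumes "R 0 \<omega> = 0"
  shows "lin_rec (\<lambda>v. v) (\<lambda>k \<omega>. X (real k / real n) \<omega> - X ((real k - 1) / real n) \<omega>)
      (\<lambda>k \<omega>. exp (R (real k / real n) \<omega> - R ((real k - 1) / real n) \<omega>)) y k \<omega> =
    exp (R (real k / real n) \<omega>) * (y + (\<Sum>i<k. exp (- R (real i / real n) \<omega>) *
      (X (real (Suc i) / real n) \<omega> - X (real i / real n) \<omega>)))"
proof (induction k)
  case 0
  then show ?case using assms by simp
next
  case (Suc k)
  define a b where "a = R (real (Suc k) / real n) \<omega>" and "b = R (real k / real n) \<omega>"
  define D where "D = X (real (Suc k) / real n) \<omega> - X (real k / real n) \<omega>"
  define S where "S = (\<Sum>i<k. exp (- R (real i / real n) \<omega>) *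
      (X (real (Suc i) / real n) \<omega> - X (real i / real n) \<omega>))"
  have 1: "real (Suc k) - 1 = real k" by simp
  have "exp (a - b) * exp b = exp a" "exp (a - b) = exp a * exp (- b)"
    by (simp_all add: exp_add[symmetric])
  then have "D * exp (a - b) + exp b * (y + S) * exp (a - b) = exp a * (y + (S + exp (- b) * D))"
    by (simp add: algebra_simps)
  then show ?case
    using Suc unfolding lin_rec.simps sum.lessThan_Suc 1 by (simp only: a_def b_def D_def S_def)
qed

lemma ou_moment_eq_mom:
  assumes BM: "indep_brownian_motions N W W'"
    and ito: "is_ito_integral_01 N (\<lambda>s \<omega>. exp (- (\<mu>\<rho> * s + \<sigma>\<rho> * W s \<omega>)))
                (\<lambda>s \<omega>. \<mu>\<xi> * s + \<sigma>\<xi> * W' s \<omega>) I"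
  shows "(\<integral>\<omega>. (exp (\<mu>\<rho> + \<sigma>\<rho> * W 1 \<omega>) * (y + I \<omega>)) ^ p \<partial>N) = mom y \<mu>\<xi> \<sigma>\<xi> \<mu>\<rho> \<sigma>\<rho> p 1"
proof -
  have W: "brownian_motion N W" and W': "brownian_motion N W'"
    using BM by (auto simp: indep_brownian_motions_def)
  interpret prob_space N using W by (rule brownian_motion_prob_space)
  have [measurable]: "W t \<in> borel_measurable N" "W' t \<in> borel_measurable N" if "t \<ge> 0" for t
    using that W W' by (auto intro: brownian_motion_measurable)
  have I_meas[measurable]: "I \<in> borel_measurable N" using ito by (simp add: is_ito_integral_01_def)
  define R X where "R t \<omega> = \<mu>\<rho> * t + \<sigma>\<rho> * W t \<omega>" and "X t \<omega> = \<mu>\<xi> * t + \<sigma>\<xi> * W' t \<omega>" for t \<omega>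
  define U V where "U n k \<omega> = X (real k / real n) \<omega> - X ((real k - 1) / real n) \<omega>"
    and "V n k \<omega> = exp (R (real k / real n) \<omega> - R ((real k - 1) / real n) \<omega>)" for n k :: nat and \<omega>
  have U_eq: "U n k \<omega> = \<mu>\<xi> / n + \<sigma>\<xi> * (W' (real k / real n) \<omega> - W' ((real k - 1) / real n) \<omega>)" for n k \<omega>
    by (simp add: U_def X_def algebra_simps diff_divide_distrib)
  have V_eq: "V n k \<omega> = exp (\<mu>\<rho> / n + \<sigma>\<rho> * (W (real k / real n) \<omega> - W ((real k - 1) / real n) \<omega>))" for n k \<omega>
    by (simp add: V_def R_def algebra_simps diff_divide_distrib)
  define u where "u n j = integral\<^sup>L (density lborel std_normal_density)
      (\<lambda>z. (\<mu>\<xi> / real n + \<sigma>\<xi> * z / sqrt (real n)) ^ j)" for n j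
  \<comment> \<open>With d(v) = v the two powers merge into one lognormal moment of order
    \<open>j + i\<close>.\<close>
  define w :: "nat \<Rightarrow> nat \<Rightarrow> nat \<Rightarrow> real" where
    "w n j i = exp ((real (j + i) * \<mu>\<rho> + (real (j + i))\<^sup>2 * \<sigma>\<rho>\<^sup>2 / 2) / real n)" for n j i
  have indep: "indep_vars (\<lambda>_. borel) (case_sum (U n) (V n)) (Inl ` {1..n} \<union> Inr ` {1..n})"
    if n: "n \<ge> 1" for n
  proof -
    define h :: "nat + nat \<Rightarrow> real \<Rightarrow> real" where
      "h = case_sum (\<lambda>_ z. \<mu>\<xi> / n + \<sigma>\<xi> * z) (\<lambda>_ z. exp (\<mu>\<rho> / n + \<sigma>\<rho> * z))"
    note indep_vars_compose2[OF indep_brownian_motions_grid_indep[OF BM n], of h "\<lambda>_. borel"]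
    moreover have "h i \<in> borel_measurable borel" for i by (auto simp: h_def split: sum.split)
    ultimately show ?thesis
      by (rule_tac iffD1[OF indep_vars_cong, rotated 3]) (auto simp: h_def U_eq V_eq fun_eq_iff)
  qed
  have U: "has_bochner_integral N (\<lambda>\<omega>. U n k \<omega> ^ j) (u n j)" if k: "k \<in> {1..n}" for n k j
    unfolding U_eq u_def
    using k by (intro normal_moment_eq_std_normal brownian_motion_grid_distributed W' prob_space_axioms) auto
  have V: "has_bochner_integral N (\<lambda>\<omega>. V n k \<omega> ^ j * V n k \<omega> ^ i) (w n j i)" if k: "k \<in> {1..n}" for n k j i
  proof -
    define s where "s = real (j + i)"
    let ?D = "\<lambda>\<omega>. W (real k / real n) \<omega> - W ((real k - 1) / real n) \<omega>"
    have "V n k \<omega> ^ j * V n k \<omega> ^ i = exp (s * \<mu>\<rho> / n) * exp ((s * \<sigma>\<rho>) * ?D \<omega>)" for \<omega>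
      unfolding V_eq power_add[symmetric] exp_of_nat_mult[symmetric] exp_add[symmetric]
      by (simp add: s_def algebra_simps add_divide_distrib)
    moreover have "w n j i = exp (s * \<mu>\<rho> / n) * exp ((s * \<sigma>\<rho>)\<^sup>2 * (sqrt (1 / real n))\<^sup>2 / 2)"
      unfolding w_def s_def[symmetric] exp_add[symmetric]
      by (simp add: power_mult_distrib add_divide_distrib)
    moreover have "has_bochner_integral N (\<lambda>\<omega>. exp ((s * \<sigma>\<rho>) * ?D \<omega>))
        (exp ((s * \<sigma>\<rho>)\<^sup>2 * (sqrt (1 / real n))\<^sup>2 / 2))"
      using k by (intro normal_exp_moment brownian_motion_grid_distributed W) auto
    ultimately show ?thesis by (simp only: has_bochner_integral_mult_right)
  qed
  define T where "T n = lin_rec (\<lambda>v. v) (U n) (V n) y n" for n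
  have T_lim: "(\<lambda>n. expectation (\<lambda>\<omega>. T n \<omega> ^ p)) \<longlonglongrightarrow> mom y \<mu>\<xi> \<sigma>\<xi> \<mu>\<rho> \<sigma>\<rho> p 1" for p
    unfolding T_def
  proof (rule lin_rec_moments_tendsto[where P = p and u = u and w = w])
    show "(\<lambda>n. real n * u n j) \<longlonglongrightarrow> (if j = 1 then \<mu>\<xi> else if j = 2 then \<sigma>\<xi>\<^sup>2 else 0)" if "1 \<le> j" for j
      unfolding u_def using that by (rule std_normal_rescaled_moment_tendsto)
    show "(\<lambda>n. real n * (w n 0 i - 1)) \<longlonglongrightarrow> real i * \<mu>\<rho> + (real i)\<^sup>2 * \<sigma>\<rho>\<^sup>2 / 2" for i
      unfolding w_def using scaled_exp_tendsto by simp
    show "(\<lambda>n. w n j i) \<longlonglongrightarrow> 1" for j i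
    proof -
      have "(\<lambda>n. exp (c / real n)) \<longlonglongrightarrow> 1" for c :: real by real_asymp
      then show ?thesis unfolding w_def .
    qed
  qed (use indep U V in auto)
  \<comment> \<open>Restricting to n = 2^m matches the dyadic mesh of
    \<open>riemann_sum\<close>.\<close>
  have T_eq: "T (2 ^ m) \<omega> = exp (R 1 \<omega>) *
      (y + riemann_sum (\<lambda>s \<omega>. exp (- (\<mu>\<rho> * s + \<sigma>\<rho> * W s \<omega>))) (\<lambda>s \<omega>. \<mu>\<xi> * s + \<sigma>\<xi> * W' s \<omega>) m \<omega>)"
    if "\<omega> \<in> space N" for m \<omega>
  proof -
    have "R 0 \<omega> = 0" using brownian_motion_0[OF W that] by (simp add: R_def)
    from lin_rec_eq_stochastic_exponential[of R, OF this, of X "2 ^ m" y "2 ^ m"]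
    show ?thesis
      unfolding T_def U_def[abs_def] V_def[abs_def] riemann_sum_def by (simp add: R_def X_def)
  qed
  let ?S = "riemann_sum (\<lambda>s \<omega>. exp (- (\<mu>\<rho> * s + \<sigma>\<rho> * W s \<omega>))) (\<lambda>s \<omega>. \<mu>\<xi> * s + \<sigma>\<xi> * W' s \<omega>)"
  have S_meas[measurable]: "?S m \<in> borel_measurable N" for m
    unfolding riemann_sum_def by measurable
  have S_lim: "tendsto_in_prob N ?S I" using ito by (simp only: is_ito_integral_01_def)
  obtain r where r: "filterlim r at_top sequentially" "AE \<omega> in N. (\<lambda>k. ?S (r k) \<omega>) \<longlonglongrightarrow> I \<omega>"
    using tendsto_in_prob_AE_subseq[OF S_meas I_meas S_lim] by blast
  have T_int: "integrable N (\<lambda>\<omega>. T n \<omega> ^ i)" if "n \<ge> 1" for n i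
    unfolding T_def using that
    by (intro lin_rec_moment_integrable[where P = i and u = "u n" and w = "w n", OF indep[OF that] _ U V]) auto
  have T_meas: "T n \<in> borel_measurable N" if "n \<ge> 1" for n
    using borel_measurable_integrable[OF T_int[OF that, of 1]] by simp
  \<comment> \<open>The bound on the second moments of the p-th powers comes from
    \<open>T_lim\<close> at order \<open>p * 2\<close>, because a convergent sequence is
    bounded.\<close>
  obtain C where C: "\<And>n. expectation (\<lambda>\<omega>. T n \<omega> ^ (p * 2)) \<le> C"
  proof -
    have "Bseq (\<lambda>n. expectation (\<lambda>\<omega>. T n \<omega> ^ (p * 2)))"
      by (rule convergent_imp_Bseq) (use T_lim in \<open>auto simp: convergent_def\<close>)
    then obtain C where "\<And>n. norm (expectation (\<lambda>\<omega>. T n \<omega> ^ (p * 2))) \<le> C"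
      by (elim BseqE) blast
    then show ?thesis using that[of C] by (auto simp: abs_le_iff)
  qed
  have "(\<lambda>k. expectation (\<lambda>\<omega>. T (2 ^ r k) \<omega> ^ p)) \<longlonglongrightarrow>
      expectation (\<lambda>\<omega>. (exp (R 1 \<omega>) * (y + I \<omega>)) ^ p)"
  proof (rule expectation_tendsto_L2_bounded)
    show "(\<lambda>\<omega>. T (2 ^ r k) \<omega> ^ p) \<in> borel_measurable N" for k
      using T_meas[of "2 ^ r k"] by simp
    show "(\<lambda>\<omega>. (exp (R 1 \<omega>) * (y + I \<omega>)) ^ p) \<in> borel_measurable N"
      unfolding R_def by measurable
    show "AE \<omega> in N. (\<lambda>k. T (2 ^ r k) \<omega> ^ p) \<longlonglongrightarrow> (exp (R 1 \<omega>) * (y + I \<omega>)) ^ p"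
      using r(2) AE_space
    proof eventually_elim
      case (elim \<omega>)
      then show ?case by (subst T_eq) (auto intro!: tendsto_intros)
    qed
    show "integrable N (\<lambda>\<omega>. (T (2 ^ r k) \<omega> ^ p)\<^sup>2)" for k
      using T_int[of "2 ^ r k" "p * 2"] by (simp add: power_mult)
    show "expectation (\<lambda>\<omega>. (T (2 ^ r k) \<omega> ^ p)\<^sup>2) \<le> C" for k
      using C[of "2 ^ r k"] by (simp add: power_mult)
  qed
  moreover have "(\<lambda>k. expectation (\<lambda>\<omega>. T (2 ^ r k) \<omega> ^ p)) \<longlonglongrightarrow> mom y \<mu>\<xi> \<sigma>\<xi> \<mu>\<rho> \<sigma>\<rho> p 1"
  proof (rule filterlim_compose[OF T_lim])
    show "filterlim (\<lambda>k. 2 ^ r k :: nat) at_top sequentially"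
      by (rule filterlim_at_top_mono[OF r(1)]) (auto intro: less_imp_le[OF less_exp])
  qed
  ultimately show ?thesis
    using LIMSEQ_unique by (simp add: R_def)
qed

section \<open>Integrability extracted from the hypotheses\<close>

lemma (in prob_space) integrable_abs_shift_power:
  fixes X :: "'a \<Rightarrow> real"
  assumes [measurable]: "X \<in> borel_measurable M" and int: "integrable M (\<lambda>x. \<bar>X x\<bar> ^ q)" and j: "j \<le> q"
  shows "integrable M (\<lambda>x. \<bar>X x - c\<bar> ^ j)"
proof (rule Bochner_Integration.integrable_bound)
  \<comment> \<open>The summand 1 makes the base \<open>\<bar>z\<bar> + b\<close> at least 1, so
    raising the exponent from \<open>j\<close> to \<open>q\<close> only increases the power.\<close>
  define b where "b = 1 + \<bar>c\<bar>"
  show "integrable M (\<lambda>x. 2 ^ q * (\<bar>X x\<bar> ^ q + b ^ q))" using int by simp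
  have "\<bar>z - c\<bar> ^ j \<le> 2 ^ q * (\<bar>z\<bar> ^ q + b ^ q)" for z
  proof -
    have "\<bar>z - c\<bar> ^ j \<le> (\<bar>z\<bar> + b) ^ j" by (intro power_mono) (auto simp: b_def)
    also have "\<dots> \<le> (\<bar>z\<bar> + b) ^ q" using j by (intro power_increasing) (auto simp: b_def)
    also have "\<dots> \<le> (2 * max \<bar>z\<bar> b) ^ q" by (intro power_mono) (auto simp: b_def max_def)
    also have "\<dots> \<le> 2 ^ q * (\<bar>z\<bar> ^ q + b ^ q)"
      by (auto simp: power_mult_distrib max_def b_def)
    finally show ?thesis .
  qed
  then show "AE x in M. norm (\<bar>X x - c\<bar> ^ j) \<le> norm (2 ^ q * (\<bar>X x\<bar> ^ q + b ^ q))"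
    by (auto intro!: AE_I2 order.trans[OF _ abs_ge_self])
qed measurable

lemma has_bochner_integral_distr_cong:
  fixes X Y :: "'a \<Rightarrow> real" and g :: "real \<Rightarrow> real"
  assumes "distr M borel X = distr M borel Y" "X \<in> borel_measurable M" "Y \<in> borel_measurable M"
    and "g \<in> borel_measurable borel" and "integrable M (\<lambda>x. g (Y x))"
  shows "has_bochner_integral M (\<lambda>x. g (X x)) (\<integral>x. g (Y x) \<partial>M)"
  using assms integrable_distr_eq[of X M borel g] integrable_distr_eq[of Y M borel g]
    integral_distr[of X M borel g] integral_distr[of Y M borel g]
  by (simp add: has_bochner_integral_iff)

text \<open>A Bochner integral would return 0 for a nonintegrable function, so the supremum is taken
  over extended nonnegative integrals. Its finiteness then yields integrability for every n of at
  least 1, as well as a real bound.\<close>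

lemma (in prob_space) nn_integral_power_SUP_finite:
  fixes f :: "nat \<Rightarrow> 'a \<Rightarrow> real"
  assumes [measurable]: "\<And>n. f n \<in> borel_measurable M" and nonneg: "\<And>n x. 0 \<le> f n x"
    and fin: "(SUP n\<in>{1..}. (\<integral>\<^sup>+ x. ennreal (f n x) \<partial>M) ^ n) < \<infinity>"
  obtains C where "\<And>n. n \<ge> 1 \<Longrightarrow> integrable M (f n)" "\<And>n. n \<ge> 1 \<Longrightarrow> expectation (f n) ^ n \<le> C"
proof -
  define S where "S = (SUP n\<in>{1..}. (\<integral>\<^sup>+ x. ennreal (f n x) \<partial>M) ^ n)"
  have le: "(\<integral>\<^sup>+ x. ennreal (f n x) \<partial>M) ^ n \<le> S" if "n \<ge> 1" for n
    unfolding S_def using that by (intro SUP_upper) auto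
  have int: "integrable M (f n)" if "n \<ge> 1" for n
  proof (rule integrableI_nonneg)
    have "(\<integral>\<^sup>+ x. ennreal (f n x) \<partial>M) ^ n < \<infinity>"
      using le[OF that] fin unfolding S_def[symmetric] by (rule le_less_trans)
    then show "(\<integral>\<^sup>+ x. ennreal (f n x) \<partial>M) < \<infinity>"
      using that by (auto simp: less_top[symmetric] power_eq_top_ennreal)
  qed (use nonneg in auto)
  moreover have "expectation (f n) ^ n \<le> enn2real S" if "n \<ge> 1" for n
  proof -
    have "ennreal (expectation (f n) ^ n) \<le> S"
      using le[OF that] nonneg int[OF that]
      by (simp add: nn_integral_eq_integral ennreal_power integral_nonneg_AE)
    also have "S = ennreal (enn2real S)" 
    proof -
      have "S < \<top>" using fin by (simp only: S_def infinity_ennreal_def)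
      then show ?thesis by simp
    qed
    finally show ?thesis by (simp add: ennreal_le_iff)
  qed
  ultimately show ?thesis using that by blast
qed

subsection \<open>The moments of the discrete process\<close>

lemma theta_grid_eq_lin_rec:
  "theta_grid \<xi> \<rho> \<mu>\<xi> \<mu>\<rho> y n k x =
    lin_rec (\<lambda>_. 1) (xi_n \<xi> \<mu>\<xi> n) (rho_n \<rho> \<mu>\<rho> n) y k x"
  by (induction k) auto

lemma (in prob_space) theta_moment_tendsto:
  fixes \<xi> \<rho> :: "nat \<Rightarrow> 'a \<Rightarrow> real"
  assumes meas_xi: "\<And>k. k \<ge> 1 \<Longrightarrow> \<xi> k \<in> borel_measurable M"
    and meas_rho: "\<And>k. k \<ge> 1 \<Longrightarrow> \<rho> k \<in> borel_measurable M"
    and indep: "indep_vars (\<lambda>_. borel) (case_sum \<xi> \<rho>) (Inl ` {1..} \<union> Inr ` {1..})"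
    and ident_xi: "\<And>k. k \<ge> 1 \<Longrightarrow> distr M borel (\<xi> k) = distr M borel (\<xi> 1)"
    and ident_rho: "\<And>k. k \<ge> 1 \<Longrightarrow> distr M borel (\<rho> k) = distr M borel (\<rho> 1)"
    and sq_lnrho: "integrable M (\<lambda>x. (ln (\<rho> 1 x))\<^sup>2)"
    and mu_xi: "\<mu>\<xi> = expectation (\<xi> 1)" and mu_rho: "\<mu>\<rho> = expectation (\<lambda>x. ln (\<rho> 1 x))"
    and sigma_xi: "\<sigma>\<xi>\<^sup>2 = expectation (\<lambda>x. (\<xi> 1 x - \<mu>\<xi>)\<^sup>2)"
    and sigma_rho: "\<sigma>\<rho>\<^sup>2 = expectation (\<lambda>x. (ln (\<rho> 1 x) - \<mu>\<rho>)\<^sup>2)"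
    and mom_q: "integrable M (\<lambda>x. \<bar>\<xi> 1 x\<bar> ^ q)"
    and sup_cond: "(SUP n\<in>{1..}. (\<integral>\<^sup>+ x. ennreal (exp (real q * gamma_n \<rho> \<mu>\<rho> n 1 x)) \<partial>M) ^ n) < \<infinity>"
    and p: "p < q"
  shows "(\<lambda>n. expectation (\<lambda>x. theta \<xi> \<rho> \<mu>\<xi> \<mu>\<rho> y n 1 x ^ p)) \<longlonglongrightarrow> mom y \<mu>\<xi> \<sigma>\<xi> \<mu>\<rho> \<sigma>\<rho> p 1"
proof -
  note One_nat_def[simp del]
  have xi1[measurable]: "\<xi> 1 \<in> borel_measurable M" and [measurable]: "\<rho> 1 \<in> borel_measurable M"
    using meas_xi meas_rho by auto
  define Z G where "Z x = \<xi> 1 x - \<mu>\<xi>" and "G x = ln (\<rho> 1 x) - \<mu>\<rho>" for x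
  have [measurable]: "Z \<in> borel_measurable M" "G \<in> borel_measurable M"
    unfolding Z_def G_def by measurable
  have Z_int: "integrable M (\<lambda>x. \<bar>Z x\<bar> ^ j)" if "j \<le> q" for j
    unfolding Z_def by (rule integrable_abs_shift_power[OF xi1 mom_q that])
  have "integrable M (\<lambda>x. \<bar>\<xi> 1 x - 0\<bar> ^ 1)"
    using p by (intro integrable_abs_shift_power[OF xi1 mom_q]) simp
  then have "integrable M (\<xi> 1)" by (simp add: integrable_abs_iff)
  then have Z0: "expectation Z = 0" unfolding Z_def by (simp add: mu_xi prob_space)
  have ln_int: "integrable M (\<lambda>x. ln (\<rho> 1 x))"
    using square_integrable_imp_integrable[OF _ sq_lnrho] by simp
  have G0: "expectation G = 0" unfolding G_def using ln_int by (simp add: mu_rho prob_space)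
  have G2: "integrable M (\<lambda>x. (G x)\<^sup>2)"
    unfolding G_def power2_diff using ln_int sq_lnrho by simp
  have gamma: "gamma_n \<rho> \<mu>\<rho> n 1 x = \<mu>\<rho> / real n + G x / sqrt (real n)" for n x
    by (simp add: gamma_n_def G_def)
  obtain C where C: "\<And>n. n \<ge> 1 \<Longrightarrow> integrable M (\<lambda>x. exp (real q * gamma_n \<rho> \<mu>\<rho> n 1 x))"
     "\<And>n. n \<ge> 1 \<Longrightarrow> expectation (\<lambda>x. exp (real q * gamma_n \<rho> \<mu>\<rho> n 1 x)) ^ n \<le> C"
  proof (rule nn_integral_power_SUP_finite[OF _ _ sup_cond])
    show "(\<lambda>x. exp (real q * gamma_n \<rho> \<mu>\<rho> n 1 x)) \<in> borel_measurable M" for n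
      unfolding gamma by measurable
  qed auto
  have exp_lim: "(\<lambda>n. real n * (expectation (\<lambda>x. exp (real i * (\<mu>\<rho> / real n + G x / sqrt (real n)))) - 1))
       \<longlonglongrightarrow> real i * \<mu>\<rho> + (real i)\<^sup>2 * expectation (\<lambda>x. (G x)\<^sup>2) / 2"
    and exp_int: "\<And>n. n \<ge> 1 \<Longrightarrow> integrable M (\<lambda>x. exp (real i * (\<mu>\<rho> / real n + G x / sqrt (real n))))"
    if "i \<le> p" for i
    using exp_moment_tendsto[of G "real i" "real q" \<mu>\<rho> C] exp_moment_integrable[of G "real i" "real q" \<mu>\<rho> C]
      C that p G0 G2 unfolding gamma by auto
  define u where "u n j = expectation (\<lambda>x. (\<mu>\<xi> / real n + Z x / sqrt (real n)) ^ j)" for n j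
  \<comment> \<open>Here d = 1, so the index \<open>j\<close> has no effect on the joint
    moment.\<close>
  define w :: "nat \<Rightarrow> nat \<Rightarrow> nat \<Rightarrow> real" where
    "w n j i = expectation (\<lambda>x. exp (real i * (\<mu>\<rho> / real n + G x / sqrt (real n))))" for n j i
  have "(\<lambda>n. expectation (\<lambda>x. lin_rec (\<lambda>_. 1) (xi_n \<xi> \<mu>\<xi> n) (rho_n \<rho> \<mu>\<rho> n) y n x ^ p))
      \<longlonglongrightarrow> mom y \<mu>\<xi> \<sigma>\<xi> \<mu>\<rho> \<sigma>\<rho> p 1"
  proof (rule lin_rec_moments_tendsto[where P = p and u = u and w = w])
    fix n :: nat assume n: "n \<ge> 1"
    define h :: "nat + nat \<Rightarrow> real \<Rightarrow> real" where
      "h = case_sum (\<lambda>_ z. \<mu>\<xi> / real n + (z - \<mu>\<xi>) / sqrt (real n))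
         (\<lambda>_ z. exp (\<mu>\<rho> / real n + (ln z - \<mu>\<rho>) / sqrt (real n)))"
    have "indep_vars (\<lambda>_. borel) (case_sum \<xi> \<rho>) (Inl ` {1..n} \<union> Inr ` {1..n})"
      by (rule indep_vars_subset[OF indep]) auto
    then have "indep_vars (\<lambda>_. borel) (\<lambda>i x. h i (case_sum \<xi> \<rho> i x)) (Inl ` {1..n} \<union> Inr ` {1..n})"
      by (rule indep_vars_compose2) (auto simp: h_def split: sum.split)
    then show "indep_vars (\<lambda>_. borel) (case_sum (xi_n \<xi> \<mu>\<xi> n) (rho_n \<rho> \<mu>\<rho> n)) (Inl ` {1..n} \<union> Inr ` {1..n})"
      by (rule iffD1[OF indep_vars_cong, rotated 3])
        (auto simp: h_def xi_n_def rho_n_def gamma_n_def fun_eq_iff)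
  next
    fix n k j :: nat assume k: "k \<in> {1..n}" and j: "j \<le> p"
    show "has_bochner_integral M (\<lambda>x. xi_n \<xi> \<mu>\<xi> n k x ^ j) (u n j)"
      unfolding u_def xi_n_def Z_def
      using has_bochner_integral_distr_cong[OF ident_xi[of k], of "\<lambda>z. (\<mu>\<xi> / real n + (z - \<mu>\<xi>) / sqrt (real n)) ^ j"]
        rescaled_moment_integrable[of Z j j \<mu>\<xi> n] Z0 Z_int k j p meas_xi
      by (simp add: Z_def)
  next
    fix n k i j :: nat assume k: "k \<in> {1..n}" and ij: "j + i \<le> p"
    have eq: "rho_n \<rho> \<mu>\<rho> n k x ^ i = exp (real i * (\<mu>\<rho> / real n + (ln (\<rho> k x) - \<mu>\<rho>) / sqrt (real n)))" for x
      by (simp add: rho_n_def gamma_n_def exp_of_nat_mult[symmetric])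
    show "has_bochner_integral M (\<lambda>x. 1 ^ j * rho_n \<rho> \<mu>\<rho> n k x ^ i) (w n j i)"
      unfolding eq w_def G_def
      using has_bochner_integral_distr_cong[OF ident_rho[of k],
          of "\<lambda>z. exp (real i * (\<mu>\<rho> / real n + (ln z - \<mu>\<rho>) / sqrt (real n)))"]
        exp_int[of i n] k ij meas_rho
      by (simp add: G_def)
  next
    show "(\<lambda>n. real n * u n j) \<longlonglongrightarrow> (if j = 1 then \<mu>\<xi> else if j = 2 then \<sigma>\<xi>\<^sup>2 else 0)"
      if "1 \<le> j" "j \<le> p" for j
      using rescaled_moment_tendsto[of Z j j \<mu>\<xi>] Z0 Z_int that p unfolding u_def sigma_xi Z_def by simp
  next
    show "(\<lambda>n. real n * (w n 0 i - 1)) \<longlonglongrightarrow> real i * \<mu>\<rho> + (real i)\<^sup>2 * \<sigma>\<rho>\<^sup>2 / 2" if "i \<le> p" for i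
      using exp_lim[OF that] unfolding w_def sigma_rho G_def by simp
  next
    show "(\<lambda>n. w n j i) \<longlonglongrightarrow> 1" if "j + i \<le> p" for j i
    proof -
      \<comment> \<open>Since n (w - 1) converges, w - 1 is a bounded sequence times 1/n.\<close>
      let ?e = "\<lambda>n. real n * (w n j i - 1)"
      have "(\<lambda>n. 1 + ?e n * (1 / real n)) \<longlonglongrightarrow>
          1 + (real i * \<mu>\<rho> + (real i)\<^sup>2 * expectation (\<lambda>x. (G x)\<^sup>2) / 2) * 0"
        using exp_lim[of i] that unfolding w_def
        by (intro tendsto_add tendsto_mult tendsto_const lim_1_over_n) auto
      then have "(\<lambda>n. 1 + ?e n * (1 / real n)) \<longlonglongrightarrow> 1" by simp
      moreover have "\<forall>\<^sub>F n in sequentially. 1 + ?e n * (1 / real n) = w n j i"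
        using eventually_ge_at_top[of 1] by eventually_elim simp
      ultimately show ?thesis by (rule Lim_transform_eventually)
    qed
  qed auto
  then show ?thesis by (simp add: theta_def theta_grid_eq_lin_rec)
qed

theorem theorem5:
  fixes M :: "'a measure" and \<xi> \<rho> :: "nat \<Rightarrow> 'a \<Rightarrow> real"
    and N :: "'b measure" and W W' :: "real \<Rightarrow> 'b \<Rightarrow> real" and I :: "'b \<Rightarrow> real"
    and y \<mu>\<xi> \<mu>\<rho> \<sigma>\<xi> \<sigma>\<rho> :: real and q p :: nat
  assumes M: "prob_space M"
    and meas_xi: "\<And>k. k \<ge> 1 \<Longrightarrow> \<xi> k \<in> borel_measurable M"
    and meas_rho: "\<And>k. k \<ge> 1 \<Longrightarrow> \<rho> k \<in> borel_measurable M"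
    and indep: "prob_space.indep_vars M (\<lambda>_. borel)
                  (\<lambda>i. case i of Inl k \<Rightarrow> \<xi> k | Inr k \<Rightarrow> \<rho> k) (Inl ` {1..} \<union> Inr ` {1..})"
    and ident_xi: "\<And>k. k \<ge> 1 \<Longrightarrow> distr M borel (\<xi> k) = distr M borel (\<xi> 1)"
    and ident_rho: "\<And>k. k \<ge> 1 \<Longrightarrow> distr M borel (\<rho> k) = distr M borel (\<rho> 1)"
    and rho_pos: "\<And>k. k \<ge> 1 \<Longrightarrow> AE x in M. \<rho> k x > 0"
    and sq_xi: "integrable M (\<lambda>x. (\<xi> 1 x)^2)"
    and sq_lnrho: "integrable M (\<lambda>x. (ln (\<rho> 1 x))^2)"
    and mu_xi: "\<mu>\<xi> = (\<integral>x. \<xi> 1 x \<partial>M)"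
    and mu_rho: "\<mu>\<rho> = (\<integral>x. ln (\<rho> 1 x) \<partial>M)"
    and sigma_xi: "\<sigma>\<xi> = sqrt (\<integral>x. (\<xi> 1 x - \<mu>\<xi>)^2 \<partial>M)"
    and sigma_rho: "\<sigma>\<rho> = sqrt (\<integral>x. (ln (\<rho> 1 x) - \<mu>\<rho>)^2 \<partial>M)"
    and var_xi_pos: "\<sigma>\<xi>^2 > 0"
    and var_rho_pos: "\<sigma>\<rho>^2 > 0"
    and q: "q \<ge> 2"
    and mom_q: "integrable M (\<lambda>x. \<bar>\<xi> 1 x\<bar> ^ q)"
    and sup_cond: "(SUP n\<in>{1..}. (\<integral>\<^sup>+ x. ennreal (exp (real q * gamma_n \<rho> \<mu>\<rho> n 1 x)) \<partial>M) ^ n) < \<infinity>"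
    and BM: "indep_brownian_motions N W W'"
    and ito: "is_ito_integral_01 N
                (\<lambda>s \<omega>. exp (- (\<mu>\<rho> * s + \<sigma>\<rho> * W s \<omega>)))
                (\<lambda>s \<omega>. \<mu>\<xi> * s + \<sigma>\<xi> * W' s \<omega>) I"
    and p: "1 \<le> p" "p < q"
  shows "(\<lambda>n. \<integral>x. (theta \<xi> \<rho> \<mu>\<xi> \<mu>\<rho> y n 1 x) ^ p \<partial>M)
            \<longlonglongrightarrow> (\<integral>\<omega>. (exp (\<mu>\<rho> + \<sigma>\<rho> * W 1 \<omega>) * (y + I \<omega>)) ^ p \<partial>N)
       \<and> (\<integral>\<omega>. (exp (\<mu>\<rho> + \<sigma>\<rho> * W 1 \<omega>) * (y + I \<omega>)) ^ p \<partial>N) = mom y \<mu>\<xi> \<sigma>\<xi> \<mu>\<rho> \<sigma>\<rho> p 1"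
proof -
  interpret prob_space M by (rule M)
  have indep': "indep_vars (\<lambda>_. borel) (case_sum \<xi> \<rho>) (Inl ` {1..} \<union> Inr ` {1..})"
    using indep by (rule iffD1[OF indep_vars_cong, rotated 3]) auto
  have "(\<lambda>n. expectation (\<lambda>x. theta \<xi> \<rho> \<mu>\<xi> \<mu>\<rho> y n 1 x ^ p)) \<longlonglongrightarrow> mom y \<mu>\<xi> \<sigma>\<xi> \<mu>\<rho> \<sigma>\<rho> p 1"
  proof (rule theta_moment_tendsto[OF meas_xi meas_rho indep' ident_xi ident_rho sq_lnrho mu_xi mu_rho
        _ _ mom_q sup_cond p(2)])
    show "\<sigma>\<xi>\<^sup>2 = expectation (\<lambda>x. (\<xi> 1 x - \<mu>\<xi>)\<^sup>2)" unfolding sigma_xi by simp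
    show "\<sigma>\<rho>\<^sup>2 = expectation (\<lambda>x. (ln (\<rho> 1 x) - \<mu>\<rho>)\<^sup>2)" unfolding sigma_rho by simp
  qed
  then show ?thesis unfolding ou_moment_eq_mom[OF BM ito] by simp
qed

end
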